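(* Let $R$ be an integrally closed integral domain of finite Krull dimension, and put $r=\dim R$. Let $O(R)$ denote the set of overrings of $R$, and let $SSFc(R)$ denote the set of semistar operations of finite character on $R$. Then the following conditions are equivalent. (i) $|O(R)|=7+\dim R$. (ii) $|SSFc(R)|=7+\dim R$. (iii) $R$ is a Prüfer domain, and one of the following holds: (a) $R$ has exactly three maximal ideals $M_1,M_2,M_3$, and $\mathrm{Spec}(R)=\{P_0,P_1,\dots,P_{r-1},M_1,M_2,M_3\}$, where $0=P_0\subsetneq P_1\subsetneq\dots\subsetneq P_{r-1}\subsetneq M_1\cap M_2\cap M_3$; or (b) $\dim R\geq 5$, $R$ has exactly two maximal ideals $M$ and $N$, and $\mathrm{Spec}(R)=\{P_0,P_1,\dots,P_{r-1},P_r=M,N\}$, where $0=P_0\subsetneq P_1\subsetneq\dots\subsetneq P_{r-1}\subsetneq P_r=M$, $P_{r-4}\nsubseteq N$ and $P_{r-5}\subsetneq N$; or (c) $\dim R\geq 2$, $R$ has exactly two maximal ideals $M$ and $N$, and $\mathrm{Spec}(R)=\{P_0,P_1,\dots,P_{r-1},P_r=M,Q,N\}$, where $0=P_0\subsetneq P_1\subsetneq\dots\subsetneq P_{r-2}\subsetneq P_{r-1}\subsetneq P_r=M$ and $P_{r-2}\subsetneq Q\subsetneq N$.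
   Context: Let $R$ be an integral domain with quotient field $L$. An overring of $R$ is a ring $T$ with $R\subseteq T\subseteq L$; both $R$ and $L$ are counted as overrings, and $O(R)$ is the set of all of them. Let $\overline{F}(R)$ be the set of all nonzero $R$-submodules of $L$. A semistar operation on $R$ is a map $*:\overline{F}(R)\to\overline{F}(R)$, $E\mapsto E^*$, such that for all $0\neq x\in L$ and all $E,F\in\overline{F}(R)$: (1) $(xE)^*=xE^*$; (2) $E\subseteq E^*$, and $E\subseteq F$ implies $E^*\subseteq F^*$; (3) $(E^* )^*=E^*$. The semistar operation $*$ is of finite character if, for every $E\in\overline{F}(R)$, $E^*=\bigcup F^*$, where $F$ ranges over the nonzero finitely generated $R$-submodules of $E$. $SSFc(R)$ is the set of all semistar operations of finite character on $R$; it includes the trivial operation $e$ given by $E^e=L$ for all $E$, and the identity operation. $\dim R$ is the Krull dimension of $R$. In each of (a), (b), (c), the listed prime ideals are pairwise distinct and are all the prime ideals of $R$. *)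

theory Defs
  imports "HOL-Algebra.Polynomials" "HOL-Algebra.Embedded_Algebras" "HOL-Algebra.Ideal_Product"
    "HOL-Library.Extended_Nat" "HOL-Library.FuncSet"
begin

text \<open>
  Throughout, \<open>L\<close> is a field and the integral domain is a subset \<open>R\<close> of its carrier, so that
  overrings and \<open>R\<close>-submodules of \<open>L\<close> are again subsets of the carrier of \<open>L\<close>.  The ring \<open>R\<close> in
  its own right is the record \<open>L\<lparr>carrier := R\<rparr>\<close>.
\<close>

definition domain_with_quotient_field :: "('a, 'm) ring_scheme \<Rightarrow> 'a set \<Rightarrow> bool" where
  "domain_with_quotient_field L R \<longleftrightarrow>
     field L \<and> subdomain R L \<and>
     (\<forall>x\<in>carrier L. \<exists>a\<in>R. \<exists>b\<in>R - {\<zero>\<^bsub>L\<^esub>}. x = a \<otimes>\<^bsub>L\<^esub> inv\<^bsub>L\<^esub> b)"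

definition overrings :: "('a, 'm) ring_scheme \<Rightarrow> 'a set \<Rightarrow> 'a set set" where
  "overrings L R = {T. subring T L \<and> R \<subseteq> T}"

text \<open>
  A polynomial of \<open>R[X]\<close> is a list of coefficients, leading coefficient first; \<open>lead_coeff\<close>
  is \<open>hd\<close>, hence the explicit condition that the list is nonempty.
\<close>

definition integral_over :: "('a, 'm) ring_scheme \<Rightarrow> 'a set \<Rightarrow> 'a \<Rightarrow> bool" where
  "integral_over L R x \<longleftrightarrow>
     (\<exists>p\<in>carrier (R[X]\<^bsub>L\<^esub>). p \<noteq> [] \<and> lead_coeff p = \<one>\<^bsub>L\<^esub> \<and> ring.eval L p x = \<zero>\<^bsub>L\<^esub>)"

definition integrally_closed :: "('a, 'm) ring_scheme \<Rightarrow> 'a set \<Rightarrow> bool" where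
  "integrally_closed L R \<longleftrightarrow> (\<forall>x\<in>carrier L. integral_over L R x \<longrightarrow> x \<in> R)"

definition prime_ideals :: "('a, 'm) ring_scheme \<Rightarrow> 'a set set" where
  "prime_ideals A = {P. primeideal P A}"

definition maximal_ideals :: "('a, 'm) ring_scheme \<Rightarrow> 'a set set" where
  "maximal_ideals A = {M. maximalideal M A}"

definition krull_dim :: "('a, 'm) ring_scheme \<Rightarrow> enat" where
  "krull_dim A =
     Sup {enat n | n. \<exists>P :: nat \<Rightarrow> 'a set.
            (\<forall>i\<le>n. P i \<in> prime_ideals A) \<and> (\<forall>i<n. P i \<subset> P (Suc i))}"

text \<open>
  The library locale \<open>subalgebra R E L\<close> says that \<open>E\<close> is an additive subgroup of \<open>L\<close> closed under
  multiplication by elements of \<open>R\<close> (no multiplicative closure is involved), that is, an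
  \<open>R\<close>-submodule of \<open>L\<close>.
\<close>

definition nonzero_submodules :: "('a, 'm) ring_scheme \<Rightarrow> 'a set \<Rightarrow> 'a set set" where
  "nonzero_submodules L R = {E. subalgebra R E L \<and> E \<noteq> {\<zero>\<^bsub>L\<^esub>}}"

definition finitely_generated :: "('a, 'm) ring_scheme \<Rightarrow> 'a set \<Rightarrow> 'a set \<Rightarrow> bool" where
  "finitely_generated L R E \<longleftrightarrow> (\<exists>Us. set Us \<subseteq> carrier L \<and> E = ring.Span L R Us)"

text \<open>
  Invertibility as a fractional ideal: the library product \<open>\<cdot>\<close> consists of the finite sums of
  products and is used here for \<open>R\<close>-submodules of \<open>L\<close>.  A submodule \<open>J\<close> with \<open>I \<cdot> J = R\<close> is
  automatically a fractional ideal, because \<open>x J \<subseteq> R\<close> for every \<open>x\<close> in \<open>I\<close>.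
\<close>

definition invertible_ideal :: "('a, 'm) ring_scheme \<Rightarrow> 'a set \<Rightarrow> 'a set \<Rightarrow> bool" where
  "invertible_ideal L R I \<longleftrightarrow> (\<exists>J\<in>nonzero_submodules L R. I \<cdot>\<^bsub>L\<^esub> J = R)"

definition pruefer_domain :: "('a, 'm) ring_scheme \<Rightarrow> 'a set \<Rightarrow> bool" where
  "pruefer_domain L R \<longleftrightarrow>
     (\<forall>I. ideal I (L\<lparr>carrier := R\<rparr>) \<and> I \<noteq> {\<zero>\<^bsub>L\<^esub>} \<and> finitely_generated L R I \<longrightarrow>
        invertible_ideal L R I)"

text \<open>
  Semistar operations are functions on \<open>nonzero_submodules L R\<close> only; the extensional function
  space makes two of them equal iff they agree there, so that they can be counted.
  The set \<open>x <# E\<close> is \<open>{x \<otimes> e | e. e \<in> E}\<close>.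
\<close>

definition semistar_operation ::
    "('a, 'm) ring_scheme \<Rightarrow> 'a set \<Rightarrow> ('a set \<Rightarrow> 'a set) \<Rightarrow> bool" where
  "semistar_operation L R s \<longleftrightarrow>
     s \<in> nonzero_submodules L R \<rightarrow>\<^sub>E nonzero_submodules L R \<and>
     (\<forall>x\<in>carrier L - {\<zero>\<^bsub>L\<^esub>}. \<forall>E\<in>nonzero_submodules L R.
        s (x <#\<^bsub>L\<^esub> E) = x <#\<^bsub>L\<^esub> s E) \<and>
     (\<forall>E\<in>nonzero_submodules L R. E \<subseteq> s E) \<and>
     (\<forall>E\<in>nonzero_submodules L R. \<forall>F\<in>nonzero_submodules L R. E \<subseteq> F \<longrightarrow> s E \<subseteq> s F) \<and>
     (\<forall>E\<in>nonzero_submodules L R. s (s E) = s E)"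

definition finite_character ::
    "('a, 'm) ring_scheme \<Rightarrow> 'a set \<Rightarrow> ('a set \<Rightarrow> 'a set) \<Rightarrow> bool" where
  "finite_character L R s \<longleftrightarrow>
     (\<forall>E\<in>nonzero_submodules L R.
        s E = \<Union> {s F | F. F \<in> nonzero_submodules L R \<and> finitely_generated L R F \<and> F \<subseteq> E})"

definition SSFc :: "('a, 'm) ring_scheme \<Rightarrow> 'a set \<Rightarrow> ('a set \<Rightarrow> 'a set) set" where
  "SSFc L R = {s. semistar_operation L R s \<and> finite_character L R s}"

end

theory Submission
  imports Defs
begin

text \<open>
  Everything rests on one elementary property.  Call \<open>R\<close> arithmetical if for all \<open>a\<close>, \<open>b\<close> in the
  quotient field there are \<open>s\<close>, \<open>c\<close>, \<open>d\<close> in \<open>R\<close> with \<open>s a = c b\<close> and \<open>(1 - s) b = d a\<close>; in the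
  localization at a prime, \<open>s\<close> or \<open>1 - s\<close> is a unit, so one of \<open>a\<close>, \<open>b\<close> divides the other.  This is
  equivalent to being a Pruefer domain (\<open>arithmetical_if_pruefer\<close>, \<open>pruefer_if_arithmetical\<close>).

  An integrally closed domain with finitely many overrings is arithmetical
  (\<open>arithmetical_if_finite_overrings\<close>): two of the rings \<open>R[x], R[x\<^sup>2], R[x\<^sup>4], \<dots>\<close> coincide, so some
  power \<open>y\<close> of \<open>x\<close> satisfies \<open>y = a + z y\<^sup>2\<close> with \<open>a\<close> in \<open>R\<close> and \<open>z\<close> in \<open>R[y]\<close>, and integral
  closedness puts \<open>z\<close> and \<open>z y\<close> into \<open>R\<close>.  An overring \<open>T\<close> gives the semistar operation
  \<open>E \<mapsto> E T\<close> of finite character, and distinct overrings give distinct operations; hence a finite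
  number of operations also makes \<open>R\<close> arithmetical.  Over an arithmetical domain there are no other
  operations, because finitely generated modules \<open>F\<close> are invertible and therefore \<open>F\<^sup>* = F R\<^sup>*\<close>
  (\<open>bij_betw_overrings_SSFc\<close>).  So both counting conditions say the same, and both imply that \<open>R\<close>
  is a Pruefer domain.

  If \<open>R\<close> is arithmetical with finite spectrum, an overring is the intersection of the localizations
  of \<open>R\<close> that contain it, and overrings correspond to nonempty downsets of \<open>Spec R\<close>
  (\<open>bij_betw_overrings_downsets\<close>).  The spectrum is a tree, and what remains is to count the downsets
  of a finite tree of height \<open>r\<close>.  Fix a longest chain \<open>P 0 < \<dots> < P r\<close>.  The chain alone accounts for
  \<open>r + 1\<close> nonempty downsets, so there must be exactly \<open>6\<close> more.  A nonempty downset \<open>F\<close> of the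
  elements off the chain extends to as many downsets as there are initial segments of the chain that
  contain everything below \<open>F\<close>, and there are at least two of those, since nothing lies above
  \<open>P r\<close>.  So there are at most three \<open>F\<close>, hence at most three elements off the chain, and the few
  configurations that remain give the three shapes of the theorem (\<open>card_downsets\<close>,
  \<open>downset_count_cases\<close>).
\<close>

section \<open>Modules, ideals and primes inside a field\<close>

lemma (in ring) subalgebra_iff:
  assumes "subring T R"
  shows "subalgebra T E R \<longleftrightarrow> E \<subseteq> carrier R \<and> \<zero> \<in> E \<and> (\<forall>x\<in>E. \<forall>y\<in>E. x \<oplus> y \<in> E) \<and>
     (\<forall>t\<in>T. \<forall>x\<in>E. t \<otimes> x \<in> E)" (is "?l \<longleftrightarrow> ?r")
proof
  assume ?l
  then interpret subalgebra T E R .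
  show ?r
    using subset one_closed m_closed smult_closed by auto
next
  assume r: ?r
  have "\<ominus> x \<in> E" if "x \<in> E" for x
  proof -
    have "\<ominus> \<one> \<in> T"
      using subringE[OF assms] by blast
    then have "\<ominus> \<one> \<otimes> x \<in> E"
      using r that by blast
    then show ?thesis
      using that r by (simp add: l_minus subset_iff)
  qed
  then have "subgroup E (add_monoid R)"
    using r by (intro add.subgroupI) (auto simp: a_inv_def)
  then show ?l
    using r by (simp add: subalgebra_def subalgebra_axioms_def)
qed

lemma (in ring) subalgebraD:
  assumes "subalgebra T E R"
  shows "E \<subseteq> carrier R" "\<zero> \<in> E" "\<And>x y. x \<in> E \<Longrightarrow> y \<in> E \<Longrightarrow> x \<oplus> y \<in> E"
    "\<And>t x. t \<in> T \<Longrightarrow> x \<in> E \<Longrightarrow> t \<otimes> x \<in> E"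
    "\<And>x. x \<in> E \<Longrightarrow> \<ominus> x \<in> E" "\<And>x y. x \<in> E \<Longrightarrow> y \<in> E \<Longrightarrow> x \<ominus> y \<in> E"
proof -
  interpret subalgebra T E R by fact
  show "E \<subseteq> carrier R" "\<zero> \<in> E" "\<And>x y. x \<in> E \<Longrightarrow> y \<in> E \<Longrightarrow> x \<oplus> y \<in> E"
    "\<And>t x. t \<in> T \<Longrightarrow> x \<in> E \<Longrightarrow> t \<otimes> x \<in> E"
    using subset one_closed m_closed smult_closed by auto
  show m: "\<And>x. x \<in> E \<Longrightarrow> \<ominus> x \<in> E"
    using m_inv_closed by (simp add: a_inv_def)
  show "\<And>x y. x \<in> E \<Longrightarrow> y \<in> E \<Longrightarrow> x \<ominus> y \<in> E"
    using m m_closed by (simp add: a_minus_def)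
qed

text \<open>
  Describing ideals of a subring inside the ambient ring lets ideals of \<open>R\<close>, ideals of its
  overrings and \<open>R\<close>-submodules of the field share one notion, free of record updates.
\<close>

lemma (in cring) ideal_in_subring_iff:
  assumes "subring T R"
  shows "ideal I (R\<lparr>carrier := T\<rparr>) \<longleftrightarrow> subalgebra T I R \<and> I \<subseteq> T" (is "?l \<longleftrightarrow> ?r")
proof
  assume ?l
  then interpret I: ideal I "R\<lparr>carrier := T\<rparr>" .
  have "I \<subseteq> T" using I.a_subset by simp
  moreover have "T \<subseteq> carrier R" using subringE[OF assms] by blast
  ultimately show ?r
    using I.a_closed additive_subgroup.zero_closed[OF I.additive_subgroup_axioms] additive_subgroup.a_closed[OF I.additive_subgroup_axioms] I.I_l_closed by (auto simp: subalgebra_iff[OF assms])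
next
  assume r: ?r
  note D = subalgebraD[OF conjunct1[OF r]]
  note T = subringE[OF assms]
  interpret T: ring "R\<lparr>carrier := T\<rparr>"
    by (rule subring_is_ring[OF assms])
  have inv: "\<exists>y\<in>I. x \<oplus> y = \<zero> " if "x \<in> I" for x
    using D(1,5) that by (intro bexI[of _ "\<ominus> x"]) (auto simp: r_neg subset_iff)
  show ?l
  proof (rule idealI)
    show "ring (R\<lparr>carrier := T\<rparr>)" by (rule T.ring_axioms)
    have "\<ominus>\<^bsub>R\<lparr>carrier := T\<rparr>\<^esub> x \<in> I" if "x \<in> I" for x
    proof -
      have x: "x \<in> T" "x \<in> carrier R" "\<ominus> x \<in> T"
        using that r D(1) T(5)[of x] by auto
      then have "\<ominus>\<^bsub>R\<lparr>carrier := T\<rparr>\<^esub> x = \<ominus> x"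
        by (intro T.minus_equality) (auto simp: l_neg)
      then show ?thesis using D(5) that by simp
    qed
    then show "subgroup I (add_monoid (R\<lparr>carrier := T\<rparr>))"
      using D r by (intro T.add.subgroupI) (auto simp: a_inv_def)
  next
    fix a x assume ax: "a \<in> I" "x \<in> carrier (R\<lparr>carrier := T\<rparr>)"
    then show "x \<otimes>\<^bsub>R\<lparr>carrier := T\<rparr>\<^esub> a \<in> I" using D by simp
    moreover have "a \<in> carrier R" "x \<in> carrier R" using ax D T by auto
    ultimately show "a \<otimes>\<^bsub>R\<lparr>carrier := T\<rparr>\<^esub> x \<in> I" by (simp add: m_comm)
  qed
qed

lemma (in cring) subring_is_cring:
  assumes "subring T R" shows "cring (R\<lparr>carrier := T\<rparr>)"
  using subcringI'[OF assms] subcring_iff[OF subringE(1)[OF assms]] by blast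

lemma (in cring) primeideal_in_subring_iff:
  assumes "subring T R"
  shows "primeideal P (R\<lparr>carrier := T\<rparr>) \<longleftrightarrow> subalgebra T P R \<and> P \<subseteq> T \<and> \<one> \<notin> P \<and>
     (\<forall>a\<in>T. \<forall>b\<in>T. a \<otimes> b \<in> P \<longrightarrow> a \<in> P \<or> b \<in> P)"
proof -
  have T: "T \<subseteq> carrier R" "\<one> \<in> T"
    using subringE[OF assms] by blast+
  have "\<one> \<in> P \<longleftrightarrow> T = P" if "subalgebra T P R \<and> P \<subseteq> T"
    using subalgebraD(4)[of T P _ \<one>] that T by (auto simp: subset_iff)
  then show ?thesis
    using subring_is_cring[OF assms]
    by (auto simp: primeideal_def primeideal_axioms_def ideal_in_subring_iff[OF assms])
qed

text \<open>
  An ideal of \<open>T\<close> that is maximal among those without \<open>\<one>\<close> is prime; Zorn's lemma provides one.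
\<close>

lemma (in cring) proper_ideal_subset_prime:
  assumes T: "subring T R" and I: "subalgebra T I R" "I \<subseteq> T" "\<one> \<notin> I"
  obtains Q where "primeideal Q (R\<lparr>carrier := T\<rparr>)" "I \<subseteq> Q"
proof -
  note TE = subringE[OF T]
  define \<A> where "\<A> = {J. subalgebra T J R \<and> J \<subseteq> T \<and> \<one> \<notin> J \<and> I \<subseteq> J}"
  have "\<exists>M\<in>\<A>. \<forall>J\<in>\<A>. M \<subseteq> J \<longrightarrow> J = M"
  proof (rule subset_Zorn_nonempty)
    show "\<A> \<noteq> {}" using I by (auto simp: \<A>_def)
  next
    fix \<C> assume C: "\<C> \<noteq> {}" "subset.chain \<A> \<C>"
    then have CA: "\<C> \<subseteq> \<A>" and lin: "\<And>J K. J \<in> \<C> \<Longrightarrow> K \<in> \<C> \<Longrightarrow> J \<subseteq> K \<or> K \<subseteq> J"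
      by (auto simp: subset.chain_def)
    have CD: "subalgebra T J R" "J \<subseteq> T" "\<one> \<notin> J" "I \<subseteq> J" if "J \<in> \<C>" for J
      using that CA by (auto simp: \<A>_def)
    have "x \<oplus> y \<in> \<Union>\<C>" if xy: "x \<in> \<Union>\<C>" "y \<in> \<Union>\<C>" for x y
    proof -
      obtain J K where JK: "x \<in> J" "J \<in> \<C>" "y \<in> K" "K \<in> \<C>" using xy by blast
      then consider "x \<in> K" | "y \<in> J" using lin by blast
      then show ?thesis
        using JK subalgebraD(3)[OF CD(1)] by cases (metis UnionI)+
    qed
    moreover have "t \<otimes> x \<in> \<Union>\<C>" if "x \<in> \<Union>\<C>" "t \<in> T" for t x
      using that subalgebraD(4)[OF CD(1)] by (metis UnionE UnionI)
    moreover have "\<Union>\<C> \<subseteq> T" "I \<subseteq> \<Union>\<C>" "\<one> \<notin> \<Union>\<C>" using C(1) CD by blast+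
    moreover have "\<zero> \<in> \<Union>\<C>" using subalgebraD(2)[OF I(1)] \<open>I \<subseteq> \<Union>\<C>\<close> by blast
    moreover have "\<Union>\<C> \<subseteq> carrier R" using \<open>\<Union>\<C> \<subseteq> T\<close> TE(1) by (rule subset_trans)
    ultimately show "\<Union>\<C> \<in> \<A>"
      unfolding \<A>_def subalgebra_iff[OF T] by simp
  qed
  then obtain Q where Q: "Q \<in> \<A>" and max: "\<And>J. J \<in> \<A> \<Longrightarrow> Q \<subseteq> J \<Longrightarrow> J = Q"
    by blast
  have Qs: "subalgebra T Q R" "Q \<subseteq> T" "\<one> \<notin> Q" "I \<subseteq> Q" using Q by (auto simp: \<A>_def)
  note QD = subalgebraD[OF Qs(1)]
  have "a \<in> Q \<or> b \<in> Q" if ab: "a \<in> T" "b \<in> T" "a \<otimes> b \<in> Q" for a b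
  proof (rule ccontr)
    assume n: "\<not> (a \<in> Q \<or> b \<in> Q)"
    have c: "a \<in> carrier R" "b \<in> carrier R" using ab TE by auto
    define J where "J = {q \<oplus> t \<otimes> a | q t. q \<in> Q \<and> t \<in> T}"
    have QJ: "Q \<subseteq> J"
    proof
      fix q assume "q \<in> Q"
      then have "q = q \<oplus> \<zero> \<otimes> a" "\<zero> \<in> T" using c QD TE by auto
      then show "q \<in> J" using \<open>q \<in> Q\<close> unfolding J_def by blast
    qed
    have "\<zero> \<oplus> \<one> \<otimes> a \<in> J" using QD(2) TE(3) unfolding J_def by blast
    then have aJ: "a \<in> J" using c by simp
    have JT: "J \<subseteq> T" using Qs(2) TE(6,7) ab unfolding J_def by auto
    have "x \<oplus> y \<in> J" if xy: "x \<in> J" "y \<in> J" for x y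
    proof -
      obtain q t q' t' where e: "x = q \<oplus> t \<otimes> a" "y = q' \<oplus> t' \<otimes> a" "q \<in> Q" "q' \<in> Q" "t \<in> T" "t' \<in> T"
        using xy unfolding J_def by blast
      then have "q \<in> carrier R" "q' \<in> carrier R" "t \<in> carrier R" "t' \<in> carrier R"
        using QD(1) TE(1) by auto
      then have "x \<oplus> y = (q \<oplus> q') \<oplus> (t \<oplus> t') \<otimes> a" using e c by algebra
      then show ?thesis using QD(3)[OF e(3,4)] TE(7)[OF e(5,6)] unfolding J_def by blast
    qed
    moreover have "u \<otimes> x \<in> J" if xy: "x \<in> J" "u \<in> T" for x u
    proof -
      obtain q t where e: "x = q \<oplus> t \<otimes> a" "q \<in> Q" "t \<in> T"
        using xy unfolding J_def by blast
      then have "q \<in> carrier R" "t \<in> carrier R" "u \<in> carrier R"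
        using QD(1) TE(1) xy by auto
      then have "u \<otimes> x = (u \<otimes> q) \<oplus> (u \<otimes> t) \<otimes> a" using e c by algebra
      then show ?thesis using QD(4)[OF xy(2) e(2)] TE(6)[OF xy(2) e(3)] unfolding J_def by blast
    qed
    moreover have "J \<subseteq> carrier R" "\<zero> \<in> J" using JT TE(1) QJ QD(2) by auto
    ultimately have "subalgebra T J R"
      unfolding subalgebra_iff[OF T] by simp
    then have "\<one> \<in> J"
      using max[of J] QJ JT Qs n aJ unfolding \<A>_def by blast
    then obtain q t where e: "\<one> = q \<oplus> t \<otimes> a" "q \<in> Q" "t \<in> T"
      unfolding J_def by blast
    have qt: "q \<in> carrier R" "t \<in> carrier R" using e QD(1) TE(1) by auto
    have "b = (q \<oplus> t \<otimes> a) \<otimes> b" using c by (simp flip: e(1))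
    also have "\<dots> = b \<otimes> q \<oplus> t \<otimes> (a \<otimes> b)" using qt c by algebra
    also have "\<dots> \<in> Q" using QD(3,4) ab e by simp
    finally show False using n by blast
  qed
  then have "primeideal Q (R\<lparr>carrier := T\<rparr>)"
    unfolding primeideal_in_subring_iff[OF T] using Qs by blast
  then show thesis using that Qs(4) by blast
qed

section \<open>Finitely generated modules and Pruefer domains\<close>

locale fraction_domain = field L for L (structure) +
  fixes R
  assumes R_subring: "subring R L"
    and R_fractions: "x \<in> carrier L \<Longrightarrow> \<exists>a\<in>R. \<exists>b\<in>R - {\<zero>}. x = a \<otimes> inv b"
begin

lemmas R_subringE = subringE[OF R_subring]

lemma R_carr: "x \<in> R \<Longrightarrow> x \<in> carrier L"
  using R_subringE(1) by auto

lemma R_minus: "x \<in> R \<Longrightarrow> y \<in> R \<Longrightarrow> x \<ominus> y \<in> R"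
  using R_subringE(5,7) by (simp add: a_minus_def)

lemma nonzero_inv:
  assumes "x \<in> carrier L" "x \<noteq> \<zero>"
  shows "inv x \<in> carrier L" "x \<otimes> inv x = \<one>" "inv x \<otimes> x = \<one>" "inv x \<noteq> \<zero>"
proof -
  have u: "x \<in> Units L" using assms field_Units by auto
  then show "inv x \<in> carrier L" "x \<otimes> inv x = \<one>" "inv x \<otimes> x = \<one>" by auto
  then show "inv x \<noteq> \<zero>" using assms one_not_zero by auto
qed

lemma nonzero_submodules_iff:
  "E \<in> nonzero_submodules L R \<longleftrightarrow> subalgebra R E L \<and> (\<exists>x\<in>E. x \<noteq> \<zero>)"
  using subalgebraD(2)[of R E] by (auto simp: nonzero_submodules_def)

declare Span.simps [simp del]

lemma Span_Nil [simp]: "Span R [] = {\<zero>}"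
  by (simp add: Span.simps)

lemma Span_Cons:
  assumes "u \<in> carrier L" "set Us \<subseteq> carrier L"
  shows "Span R (u # Us) = {k \<otimes> u \<oplus> v | k v. k \<in> R \<and> v \<in> Span R Us}"
  unfolding Span.simps foldr.simps comp_def
  by (auto simp: line_extension_def set_add_def set_mult_def r_coset_def)

lemma Span_submodule:
  "set Us \<subseteq> carrier L \<Longrightarrow> subalgebra R (Span R Us) L"
proof (induction Us)
  case Nil
  then show ?case using R_carr by (auto simp: subalgebra_iff[OF R_subring])
next
  case (Cons u Us)
  then have u: "u \<in> carrier L" and Us: "set Us \<subseteq> carrier L" by auto
  note D = subalgebraD[OF Cons.IH[OF Us]]
  have "\<zero> = \<zero> \<otimes> u \<oplus> \<zero>" using u by simp
  then have "\<exists>k v. \<zero> = k \<otimes> u \<oplus> v \<and> k \<in> R \<and> v \<in> Span R Us"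
    using D(2) R_subringE(2) by blast
  moreover have "\<exists>k v. x \<oplus> y = k \<otimes> u \<oplus> v \<and> k \<in> R \<and> v \<in> Span R Us"
    if xy: "x \<in> Span R (u # Us)" "y \<in> Span R (u # Us)" for x y
  proof -
    obtain k v k' v' where e: "x = k \<otimes> u \<oplus> v" "k \<in> R" "v \<in> Span R Us"
      "y = k' \<otimes> u \<oplus> v'" "k' \<in> R" "v' \<in> Span R Us"
      using xy by (auto simp: Span_Cons[OF u Us])
    then have "k \<in> carrier L" "k' \<in> carrier L" "v \<in> carrier L" "v' \<in> carrier L"
      using R_carr D(1) by auto
    then have "x \<oplus> y = (k \<oplus> k') \<otimes> u \<oplus> (v \<oplus> v')"
      using u unfolding e by algebra
    then show ?thesis using R_subringE(7)[OF e(2,5)] D(3)[OF e(3,6)] by blast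
  qed
  moreover have "\<exists>k v. t \<otimes> x = k \<otimes> u \<oplus> v \<and> k \<in> R \<and> v \<in> Span R Us"
    if tx: "x \<in> Span R (u # Us)" "t \<in> R" for x t
  proof -
    obtain k v where e: "x = k \<otimes> u \<oplus> v" "k \<in> R" "v \<in> Span R Us"
      using tx unfolding Span_Cons[OF u Us] by blast
    then have "k \<in> carrier L" "v \<in> carrier L" "t \<in> carrier L"
      using R_carr D(1) tx by auto
    then have "t \<otimes> x = (t \<otimes> k) \<otimes> u \<oplus> (t \<otimes> v)"
      using u unfolding e by algebra
    then show ?thesis using R_subringE(6)[OF tx(2) e(2)] D(4)[OF tx(2) e(3)] by blast
  qed
  moreover have "Span R (u # Us) \<subseteq> carrier L"
    using u D(1) R_carr unfolding Span_Cons[OF u Us] by auto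
  ultimately show ?case
    unfolding subalgebra_iff[OF R_subring] unfolding Span_Cons[OF u Us] by simp
qed

lemma Span_superset:
  "set Us \<subseteq> carrier L \<Longrightarrow> set Us \<subseteq> Span R Us"
proof (induction Us)
  case (Cons u Us)
  then have u: "u \<in> carrier L" and Us: "set Us \<subseteq> carrier L" by auto
  note D = subalgebraD[OF Span_submodule[OF Us]]
  have "u = \<one> \<otimes> u \<oplus> \<zero>" using u by simp
  then have "u \<in> Span R (u # Us)"
    using D(2) R_subringE(3) unfolding Span_Cons[OF u Us] by blast
  moreover have "v \<in> Span R (u # Us)" if "v \<in> set Us" for v
  proof -
    have "v = \<zero> \<otimes> u \<oplus> v" "v \<in> Span R Us" using u Us that Cons.IH by auto
    then show ?thesis using R_subringE(2) unfolding Span_Cons[OF u Us] by blast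
  qed
  ultimately show ?case by (simp add: subset_iff)
qed simp

lemma Span_least:
  "set Us \<subseteq> E \<Longrightarrow> subalgebra R E L \<Longrightarrow> Span R Us \<subseteq> E"
proof (induction Us)
  case Nil then show ?case using subalgebraD(2) by auto
next
  case (Cons u Us)
  note D = subalgebraD[OF Cons.prems(2)]
  have u: "u \<in> carrier L" and Us: "set Us \<subseteq> carrier L" using Cons.prems D(1) by auto
  show ?case
    using Cons D(3,4) unfolding Span_Cons[OF u Us] by auto
qed

lemma principal_submodule:
  assumes "x \<in> carrier L"
  shows "x <# R = Span R [x]"
proof -
  have "x \<otimes> r = r \<otimes> x \<oplus> \<zero>" if "r \<in> R" for r
    using assms that R_carr by (simp add: m_comm)
  then show ?thesis
    unfolding l_coset_def by (auto simp: Span_Cons[OF assms])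
qed

lemma prod_least:
  assumes T: "subring T L" and H: "subalgebra T H L"
    and "\<And>x y. x \<in> E \<Longrightarrow> y \<in> F \<Longrightarrow> x \<otimes> y \<in> H"
  shows "E \<cdot> F \<subseteq> H"
proof
  fix z assume "z \<in> E \<cdot> F"
  then show "z \<in> H"
    by induction (auto intro: assms subalgebraD(3)[OF H])
qed

lemma prod_submodule:
  assumes T: "subring T L" and E: "subalgebra S E L" and F: "subalgebra T F L"
  shows "subalgebra T (E \<cdot> F) L"
proof -
  note D = subalgebraD[OF E] and D' = subalgebraD[OF F]
  have c: "E \<cdot> F \<subseteq> carrier L"
  proof
    fix z assume "z \<in> E \<cdot> F" then show "z \<in> carrier L"
      by induction (use D(1) D'(1) in auto)
  qed
  have "\<zero> \<otimes> \<zero> \<in> E \<cdot> F" by (rule ideal_prod.prod[OF D(2) D'(2)])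
  moreover have "t \<otimes> z \<in> E \<cdot> F" if t: "t \<in> T" and "z \<in> E \<cdot> F" for t z
    using that(2)
  proof induction
    case (prod i j)
    have "t \<otimes> (i \<otimes> j) = i \<otimes> (t \<otimes> j)"
      using prod t D(1) D'(1) subringE(1)[OF T] by (intro m_lcomm) auto
    then show ?case using ideal_prod.prod[OF prod(1) D'(4)[OF t prod(2)]] by simp
  next
    case (sum z w)
    have "t \<otimes> (z \<oplus> w) = t \<otimes> z \<oplus> t \<otimes> w"
      using c sum t subringE(1)[OF T] by (intro r_distr) auto
    then show ?case using ideal_prod.sum[OF sum(3,4)] by simp
  qed
  ultimately show ?thesis
    using c ideal_prod.sum unfolding subalgebra_iff[OF T] by auto
qed

text \<open>
  This is the fractional ideal \<open>(R : I)\<close>, the only candidate for an inverse of \<open>I\<close>.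
\<close>

definition colon :: "'a set \<Rightarrow> 'a set" where
  "colon I = {y \<in> carrier L. \<forall>x\<in>I. y \<otimes> x \<in> R}"

lemma colon_submodule:
  assumes "subalgebra R I L" shows "subalgebra R (colon I) L"
proof -
  note D = subalgebraD(1)[OF assms]
  have "(x \<oplus> y) \<otimes> z \<in> R" if "x \<in> colon I" "y \<in> colon I" "z \<in> I" for x y z
    using that D R_subringE(7)[of "x \<otimes> z" "y \<otimes> z"] by (auto simp: colon_def l_distr subset_iff)
  moreover have "(t \<otimes> y) \<otimes> z \<in> R" if "t \<in> R" "y \<in> colon I" "z \<in> I" for t y z
    using that D R_carr R_subringE(6)[of t "y \<otimes> z"] by (auto simp: colon_def m_assoc subset_iff)
  ultimately show ?thesis
    unfolding subalgebra_iff[OF R_subring]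
    using D R_subringE(2) R_carr by (auto simp: colon_def subset_iff)
qed

text \<open>
  At every prime, \<open>s\<close> or \<open>\<one> \<ominus> s\<close> is a unit, so the localizations of \<open>R\<close> are valuation rings.
  The two equations are free of inverses and therefore make sense when \<open>a\<close> or \<open>b\<close> is zero.
\<close>

definition arithmetical :: bool where
  "arithmetical \<longleftrightarrow> (\<forall>a\<in>carrier L. \<forall>b\<in>carrier L. \<exists>s\<in>R. \<exists>c\<in>R. \<exists>d\<in>R.
      s \<otimes> a = c \<otimes> b \<and> (\<one> \<ominus> s) \<otimes> b = d \<otimes> a)"

lemma arithmeticalE:
  assumes arithmetical "a \<in> carrier L" "b \<in> carrier L"
  obtains s c d where "s \<in> R" "c \<in> R" "d \<in> R" "s \<otimes> a = c \<otimes> b" "(\<one> \<ominus> s) \<otimes> b = d \<otimes> a"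
  using assms unfolding arithmetical_def by blast

lemma arithmeticalI:
  assumes "\<And>x. x \<in> carrier L \<Longrightarrow> x \<noteq> \<zero> \<Longrightarrow> \<exists>s\<in>R. s \<otimes> x \<in> R \<and> (\<exists>d\<in>R. \<one> \<ominus> s = d \<otimes> x)"
  shows arithmetical
  unfolding arithmetical_def
proof (intro ballI)
  fix a b assume c: "a \<in> carrier L" "b \<in> carrier L"
  consider "a = \<zero>" | "b = \<zero>" | "a \<noteq> \<zero>" "b \<noteq> \<zero>" by blast
  then show "\<exists>s\<in>R. \<exists>c\<in>R. \<exists>d\<in>R. s \<otimes> a = c \<otimes> b \<and> (\<one> \<ominus> s) \<otimes> b = d \<otimes> a"
  proof cases
    case 1
    show ?thesis
      by (rule bexI[of _ \<one>], rule bexI[of _ \<zero>], rule bexI[of _ \<zero>])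
        (use 1 c R_subringE in \<open>auto simp: a_minus_def r_neg\<close>)
  next
    case 2
    show ?thesis
      by (rule bexI[of _ \<zero>], rule bexI[of _ \<zero>], rule bexI[of _ \<zero>])
        (use 2 c R_subringE in \<open>auto simp: a_minus_def\<close>)
  next
    case 3
    note i = nonzero_inv[OF c(2) 3(2)]
    have "a \<otimes> inv b \<noteq> \<zero>" using integral[of a "inv b"] c 3 i by auto
    then obtain s d where s: "s \<in> R" "s \<otimes> (a \<otimes> inv b) \<in> R" "d \<in> R" "\<one> \<ominus> s = d \<otimes> (a \<otimes> inv b)"
      using assms[of "a \<otimes> inv b"] c i by auto
    have sd: "s \<in> carrier L" "d \<in> carrier L" using s R_carr by auto
    have ab: "(a \<otimes> inv b) \<otimes> b = a" using c i by (simp add: m_assoc)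
    have "s \<otimes> a = (s \<otimes> (a \<otimes> inv b)) \<otimes> b" using ab c i sd by (simp add: m_assoc)
    moreover have "(\<one> \<ominus> s) \<otimes> b = d \<otimes> a" using ab c i sd unfolding s(4) by (simp add: m_assoc)
    ultimately show ?thesis using s by blast
  qed
qed

text \<open>
  Adding a generator \<open>a\<close> to \<open>I\<close> does not shrink \<open>I (R : I)\<close>.  For \<open>b\<close> in \<open>I\<close> and \<open>y\<close> in \<open>(R : I)\<close>,
  take \<open>s a = e b\<close> and \<open>(1 - s) b = d a\<close>; then \<open>b y = b (s y) + a (d y)\<close>, and \<open>s y\<close> and \<open>d y\<close>
  multiply \<open>a\<close> into \<open>R\<close> as well.
\<close>

lemma prod_colon_subset_adjoin:
  assumes ar: arithmetical and I: "subalgebra R I L" and I': "subalgebra R I' L"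
    and a: "a \<in> carrier L" and I'_def: "I' = {k \<otimes> a \<oplus> v | k v. k \<in> R \<and> v \<in> I}"
  shows "I \<cdot> colon I \<subseteq> I' \<cdot> colon I'"
proof (rule prod_least[OF R_subring prod_submodule[OF R_subring I' colon_submodule[OF I']]])
  note D = subalgebraD[OF I] and D' = subalgebraD[OF I']
  have aI': "a \<in> I'" and II': "v \<in> I'" if "v \<in> I" for v
  proof -
    have "a = \<one> \<otimes> a \<oplus> \<zero>" using a by simp
    then show "a \<in> I'" unfolding I'_def using D(2) R_subringE(3) by blast
    have "v = \<zero> \<otimes> a \<oplus> v" using a that D(1) by auto
    then show "v \<in> I'" unfolding I'_def using that R_subringE(2) by blast
  qed
  have colonI: "y \<in> colon I'" if "y \<in> colon I" "y \<otimes> a \<in> R" for y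
  proof -
    have "y \<otimes> (k \<otimes> a \<oplus> v) \<in> R" if kv: "k \<in> R" "v \<in> I" for k v
    proof -
      have y: "y \<in> carrier L" "y \<otimes> v \<in> R" using \<open>y \<in> colon I\<close> kv by (auto simp: colon_def)
      have c: "k \<in> carrier L" "v \<in> carrier L" using kv D(1) R_carr by auto
      have "y \<otimes> (k \<otimes> a \<oplus> v) = k \<otimes> (y \<otimes> a) \<oplus> y \<otimes> v" using y c a by algebra
      then show ?thesis using R_subringE(6)[OF kv(1) \<open>y \<otimes> a \<in> R\<close>] R_subringE(7) y(2) by simp
    qed
    then show ?thesis using that(1) by (auto simp: colon_def I'_def)
  qed
  fix b y assume h: "b \<in> I" "y \<in> colon I"
  from h have c: "b \<in> carrier L" "y \<in> carrier L" "y \<otimes> b \<in> R" using D(1) by (auto simp: colon_def)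
  obtain s e d where s: "s \<in> R" "e \<in> R" "d \<in> R" "s \<otimes> a = e \<otimes> b" "(\<one> \<ominus> s) \<otimes> b = d \<otimes> a"
    using arithmeticalE[OF ar a c(1)] .
  have sc: "s \<in> carrier L" "e \<in> carrier L" "d \<in> carrier L" using s R_carr by auto
  note M = subalgebraD[OF colon_submodule[OF I]]
  have 1: "s \<otimes> y \<in> colon I'"
  proof (rule colonI)
    have "(s \<otimes> y) \<otimes> a = y \<otimes> (s \<otimes> a)" using a c sc by algebra
    also have "\<dots> = e \<otimes> (y \<otimes> b)" unfolding s(4) using a c sc by algebra
    finally show "(s \<otimes> y) \<otimes> a \<in> R" using R_subringE(6)[OF s(2) c(3)] by simp
  qed (use M(4) s h in auto)
  have 2: "d \<otimes> y \<in> colon I'"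
  proof (rule colonI)
    have "(d \<otimes> y) \<otimes> a = y \<otimes> (d \<otimes> a)" using a c sc by algebra
    also have "\<dots> = (\<one> \<ominus> s) \<otimes> (y \<otimes> b)" unfolding s(5)[symmetric] using a c sc by algebra
    finally show "(d \<otimes> y) \<otimes> a \<in> R" using R_subringE(6)[OF R_minus c(3)] R_subringE(3) s(1) by simp
  qed (use M(4) s h in auto)
  have "b \<otimes> y = b \<otimes> (s \<otimes> y) \<oplus> ((\<one> \<ominus> s) \<otimes> b) \<otimes> y" using c sc by algebra
  also have "\<dots> = b \<otimes> (s \<otimes> y) \<oplus> a \<otimes> (d \<otimes> y)"
    unfolding s(5) using a c sc by algebra
  also have "\<dots> \<in> I' \<cdot> colon I'"
    using 1 2 aI'[OF h(1)] II'[OF h(1)] by (intro ideal_prod.intros) auto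
  finally show "b \<otimes> y \<in> I' \<cdot> colon I'" .
qed

text \<open>
  A single generator \<open>a\<close> is inverted by \<open>inv a\<close>, and further generators preserve
  \<open>1 \<in> I (R : I)\<close>.
\<close>

lemma one_in_prod_colon:
  assumes ar: arithmetical and "set Us \<subseteq> carrier L" "Span R Us \<noteq> {\<zero>}"
  shows "\<one> \<in> Span R Us \<cdot> colon (Span R Us)"
  using assms(2,3)
proof (induction Us)
  case (Cons a Us)
  then have a: "a \<in> carrier L" and Us: "set Us \<subseteq> carrier L" by auto
  note I' = Span_submodule[OF Cons.prems(1)]
  show ?case
  proof (cases "Span R Us = {\<zero>}")
    case False
    then show ?thesis
      using Cons.IH[OF Us] prod_colon_subset_adjoin[OF ar Span_submodule[OF Us] I' a Span_Cons[OF a Us]]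
      by blast
  next
    case True
    have e: "Span R (a # Us) = {k \<otimes> a | k. k \<in> R}"
      unfolding Span_Cons[OF a Us] True using a R_carr by force
    have "a \<noteq> \<zero>"
    proof
      assume "a = \<zero>"
      then have "Span R (a # Us) \<subseteq> {\<zero>}" unfolding e using R_carr by auto
      then show False using Cons.prems(2) subalgebraD(2)[OF I'] by blast
    qed
    note i = nonzero_inv[OF a this]
    have "inv a \<in> colon (Span R (a # Us))"
    proof -
      have "inv a \<otimes> (k \<otimes> a) = k" if "k \<in> R" for k
        using that R_carr[of k] a i m_lcomm[of "inv a" k a] by simp
      then show ?thesis unfolding colon_def e using i by auto
    qed
    moreover have "a \<in> Span R (a # Us)" using Span_superset[OF Cons.prems(1)] by auto
    ultimately show ?thesis using ideal_prod.prod i(2) by metis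
  qed
qed simp

lemma prod_colon_subset: "I \<subseteq> carrier L \<Longrightarrow> I \<cdot> colon I \<subseteq> R"
proof
  fix z assume I: "I \<subseteq> carrier L" and "z \<in> I \<cdot> colon I"
  from this(2) show "z \<in> R"
    by induction (use I R_subringE(7) in \<open>auto simp: colon_def m_comm subset_iff\<close>)
qed

text \<open>
  For \<open>x = a / b\<close>, invertibility of the ideal \<open>(a, b)\<close> gives \<open>1 = a y + b y'\<close> with \<open>y\<close>, \<open>y'\<close> in the
  inverse, and \<open>s = b y'\<close> works.
\<close>

lemma arithmetical_if_pruefer:
  assumes "pruefer_domain L R" shows arithmetical
proof (rule arithmeticalI)
  fix x assume x: "x \<in> carrier L" "x \<noteq> \<zero>"
  obtain a b where ab: "a \<in> R" "b \<in> R" "b \<noteq> \<zero>" "x = a \<otimes> inv b" using R_fractions[OF x(1)] by auto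
  have c: "a \<in> carrier L" "b \<in> carrier L" using ab R_carr by auto
  note i = nonzero_inv[OF c(2) ab(3)]
  have xb: "x \<otimes> b = a" unfolding ab using c i by (simp add: m_assoc)
  define I where "I = Span R [a, b]"
  have Us: "set [a, b] \<subseteq> carrier L" using c by simp
  have I: "subalgebra R I L" unfolding I_def by (rule Span_submodule[OF Us])
  have "subalgebra R R L"
    using R_subringE unfolding subalgebra_iff[OF R_subring] by auto
  then have IR: "I \<subseteq> R"
    unfolding I_def using ab by (intro Span_least) auto
  have mem: "a \<in> I" "b \<in> I" using Span_superset[OF Us] unfolding I_def by auto
  have "ideal I (L\<lparr>carrier := R\<rparr>)" "finitely_generated L R I" "I \<noteq> {\<zero>}"
    using ideal_in_subring_iff[OF R_subring] I IR Us mem ab(3) I_def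
    unfolding finitely_generated_def by blast+
  then obtain J where J: "subalgebra R J L" "I \<cdot> J = R"
    using assms unfolding pruefer_domain_def invertible_ideal_def nonzero_submodules_def by blast
  note DJ = subalgebraD[OF J(1)]
  have IJ: "v \<otimes> y \<in> R" if "v \<in> I" "y \<in> J" for v y
    using ideal_prod.prod[OF that, of L] J(2) by auto
  have "\<exists>y\<in>J. \<exists>y'\<in>J. z = a \<otimes> y \<oplus> b \<otimes> y'" if "z \<in> I \<cdot> J" for z
    using that
  proof induction
    case (prod v y)
    obtain k l where kl: "k \<in> R" "l \<in> R" "v = k \<otimes> a \<oplus> l \<otimes> b"
      using prod(1) c R_carr unfolding I_def
      by (auto simp: Span_Cons[OF c(1), of "[b]"] Span_Cons[OF c(2), of "[]"])
    have "k \<in> carrier L" "l \<in> carrier L" "y \<in> carrier L" using kl R_carr DJ(1) prod by auto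
    then have "v \<otimes> y = a \<otimes> (k \<otimes> y) \<oplus> b \<otimes> (l \<otimes> y)" using c unfolding kl by algebra
    then show ?case using DJ(4)[OF kl(1) prod(2)] DJ(4)[OF kl(2) prod(2)] by blast
  next
    case (sum z w)
    then obtain y y' u u' where e: "y \<in> J" "y' \<in> J" "u \<in> J" "u' \<in> J"
      "z = a \<otimes> y \<oplus> b \<otimes> y'" "w = a \<otimes> u \<oplus> b \<otimes> u'" by blast
    then have "y \<in> carrier L" "y' \<in> carrier L" "u \<in> carrier L" "u' \<in> carrier L" using DJ(1) by auto
    then have "z \<oplus> w = a \<otimes> (y \<oplus> u) \<oplus> b \<otimes> (y' \<oplus> u')" using c unfolding e by algebra
    then show ?case using DJ(3)[OF e(1,3)] DJ(3)[OF e(2,4)] by blast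
  qed
  then obtain y y' where y: "y \<in> J" "y' \<in> J" "\<one> = a \<otimes> y \<oplus> b \<otimes> y'"
    using R_subringE(3) J(2) by blast
  have yc: "y \<in> carrier L" "y' \<in> carrier L" using y DJ(1) by auto
  show "\<exists>s\<in>R. s \<otimes> x \<in> R \<and> (\<exists>d\<in>R. \<one> \<ominus> s = d \<otimes> x)"
  proof (intro bexI conjI)
    have "(b \<otimes> y') \<otimes> x = (x \<otimes> b) \<otimes> y'" using c yc x by algebra
    then show "(b \<otimes> y') \<otimes> x \<in> R" unfolding xb using IJ[OF mem(1) y(2)] by simp
    have "\<one> \<ominus> b \<otimes> y' = (x \<otimes> b) \<otimes> y" unfolding xb y(3) using c yc by algebra
    also have "\<dots> = (b \<otimes> y) \<otimes> x" using c yc x by algebra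
    finally show "\<one> \<ominus> b \<otimes> y' = (b \<otimes> y) \<otimes> x" .
    show "b \<otimes> y' \<in> R" "b \<otimes> y \<in> R" using IJ[OF mem(2)] y by auto
  qed
qed

lemma pruefer_if_arithmetical:
  assumes ar: arithmetical shows "pruefer_domain L R"
  unfolding pruefer_domain_def
proof (intro allI impI, elim conjE)
  fix I assume I: "ideal I (L\<lparr>carrier := R\<rparr>)" "I \<noteq> {\<zero>}" "finitely_generated L R I"
  obtain Us where Us: "set Us \<subseteq> carrier L" "I = Span R Us"
    using I(3) unfolding finitely_generated_def by blast
  have Is: "subalgebra R I L" unfolding Us by (rule Span_submodule[OF Us(1)])
  have one: "\<one> \<in> I \<cdot> colon I" using one_in_prod_colon[OF ar Us(1)] I(2) unfolding Us(2) by blast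
  note C = colon_submodule[OF Is]
  note P = subalgebraD[OF prod_submodule[OF R_subring Is C]]
  have "R \<subseteq> I \<cdot> colon I"
  proof
    fix x assume "x \<in> R"
    then have "x \<otimes> \<one> \<in> I \<cdot> colon I" using P(4) one by blast
    then show "x \<in> I \<cdot> colon I" using \<open>x \<in> R\<close> R_carr by simp
  qed
  then have eq: "I \<cdot> colon I = R"
    using prod_colon_subset[OF subalgebraD(1)[OF Is]] by blast
  moreover have "colon I \<noteq> {\<zero>}"
  proof
    assume z: "colon I = {\<zero>}"
    have "x = \<zero>" if "x \<in> I \<cdot> colon I" for x
      using that by induction (use z subalgebraD(1)[OF Is] in auto)
    from this[OF one] show False by simp
  qed
  ultimately show "invertible_ideal L R I"
    using C unfolding invertible_ideal_def nonzero_submodules_def by blast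
qed

end

section \<open>Integrally closed domains with finitely many overrings\<close>

context fraction_domain
begin

lemma integral_overI:
  assumes "set p \<subseteq> R" "p \<noteq> []" "hd p = \<one>" "eval p x = \<zero>"
  shows "integral_over L R x"
  using assms univ_poly_carrier[of L R p] unfolding integral_over_def polynomial_def by auto

lemma root_closed:
  assumes ic: "integrally_closed L R" and u: "u \<in> carrier L" "u [^] Suc n \<in> R"
  shows "u \<in> R"
proof -
  let ?p = "monom \<one> n @ [\<ominus> (u [^] Suc n)]"
  have c: "set (monom \<one> n) \<subseteq> carrier L" by (auto simp: monom_def)
  have "eval ?p u = eval (monom \<one> n) u \<otimes> u \<oplus> \<ominus> (u [^] Suc n)"
    using c u(1) by (intro eval_append_aux) auto
  then have "eval ?p u = \<zero>"
    using u(1) by (simp add: eval_monom r_neg)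
  moreover have "set ?p \<subseteq> R" "hd ?p = \<one>"
    using R_subringE(2,3) R_subringE(5)[OF u(2)] by (auto simp: monom_def)
  ultimately have "integral_over L R u"
    by (intro integral_overI) auto
  then show ?thesis using ic u unfolding integrally_closed_def by blast
qed

text \<open>
  If \<open>x\<close> is a root of \<open>a X\<^sup>m + b\<^sub>1 X\<^bsup>m-1\<^esup> + \<dots> + b\<^sub>m\<close>, then \<open>a x\<close> is a root of the monic polynomial
  with lower coefficients \<open>b\<^sub>1, b\<^sub>2 a, \<dots>, b\<^sub>m a\<^bsup>m-1\<^esup>\<close>; this is the list for \<open>c = \<one>\<close>.
\<close>

primrec rescale :: "'a \<Rightarrow> 'a list \<Rightarrow> 'a \<Rightarrow> 'a list" where
  "rescale a [] c = []"
| "rescale a (b # q) c = (b \<otimes> c) # rescale a q (c \<otimes> a)"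

lemma length_rescale [simp]: "length (rescale a q c) = length q"
  by (induction q arbitrary: c) auto

lemma rescale_closed:
  "subring T L \<Longrightarrow> set q \<subseteq> T \<Longrightarrow> a \<in> T \<Longrightarrow> c \<in> T \<Longrightarrow> set (rescale a q c) \<subseteq> T"
  by (induction q arbitrary: c) (auto intro: subringE(6))

text \<open>
  The factor \<open>a\<close> on the left replaces the exponent \<open>length q - 1\<close> on the right, which would be
  wrong for the empty list.
\<close>

lemma eval_rescale:
  assumes "a \<in> carrier L" "x \<in> carrier L"
  shows "set q \<subseteq> carrier L \<Longrightarrow> c \<in> carrier L \<Longrightarrow>
    a \<otimes> eval (rescale a q c) (a \<otimes> x) = (c \<otimes> a [^] length q) \<otimes> eval q x"
proof (induction q arbitrary: c)
  case (Cons b q)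
  have E: "eval (rescale a q (c \<otimes> a)) (a \<otimes> x) \<in> carrier L" "eval q x \<in> carrier L"
    using rescale_closed[OF carrier_is_subring, of q a "c \<otimes> a"] Cons assms
    by (auto intro!: eval_in_carrier)
  have b: "b \<in> carrier L" using Cons by auto
  have IH: "a \<otimes> eval (rescale a q (c \<otimes> a)) (a \<otimes> x) = ((c \<otimes> a) \<otimes> a [^] length q) \<otimes> eval q x"
    using Cons assms by auto
  have pw: "(a \<otimes> x) [^] length q = a [^] length q \<otimes> x [^] length q"
    using assms by (simp add: nat_pow_distrib)
  have A: "a [^] length q \<in> carrier L" "x [^] length q \<in> carrier L" using assms by auto
  have "a \<otimes> eval (rescale a (b # q) c) (a \<otimes> x) =
      a \<otimes> (b \<otimes> c \<otimes> (a [^] length q \<otimes> x [^] length q)) \<oplus> a \<otimes> eval (rescale a q (c \<otimes> a)) (a \<otimes> x)"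
    using E b A assms Cons.prems by (simp add: pw r_distr)
  also have "\<dots> = (c \<otimes> (a [^] length q \<otimes> a)) \<otimes> (b \<otimes> x [^] length q \<oplus> eval q x)"
    unfolding IH using E b A assms Cons.prems by algebra
  finally show ?case by simp
qed (use assms in simp)

lemma leading_coeff_times_root:
  assumes ic: "integrally_closed L R" and x: "x \<in> carrier L"
    and p: "set (a # q) \<subseteq> R" "eval (a # q) x = \<zero>"
  shows "a \<otimes> x \<in> R"
proof (cases "a = \<zero>")
  case True
  then show ?thesis using x R_subringE(2) by simp
next
  case False
  let ?p = "\<one> # rescale a q \<one>"
  have a: "a \<in> carrier L" and q: "set q \<subseteq> carrier L" using p R_carr by auto
  have sub: "set ?p \<subseteq> R" using rescale_closed[OF R_subring, of q a \<one>] p R_subringE(3) by auto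
  then have E: "eval (rescale a q \<one>) (a \<otimes> x) \<in> carrier L" "eval q x \<in> carrier L"
    using R_carr a x q by (auto intro!: eval_in_carrier)
  have A: "a [^] length q \<in> carrier L" "x [^] length q \<in> carrier L" using a x by auto
  have "a \<otimes> eval ?p (a \<otimes> x) = a \<otimes> (a [^] length q \<otimes> x [^] length q) \<oplus> a \<otimes> eval (rescale a q \<one>) (a \<otimes> x)"
    using E A a x by (simp add: nat_pow_distrib r_distr)
  also have "\<dots> = a [^] length q \<otimes> (a \<otimes> x [^] length q \<oplus> eval q x)"
    using eval_rescale[OF a x q one_closed] E A a x by (simp add: r_distr m_lcomm)
  also have "\<dots> = \<zero>" using p(2) A by simp
  finally have "eval ?p (a \<otimes> x) = \<zero>"
    using integral[of a "eval ?p (a \<otimes> x)"] False a x sub R_carr by (auto intro!: eval_in_carrier)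
  then have "integral_over L R (a \<otimes> x)"
    using sub by (intro integral_overI[of ?p]) auto
  then show ?thesis using ic a x unfolding integrally_closed_def by blast
qed

text \<open>
  These are the intermediate values of Horner's scheme.  Each of them is the leading coefficient of
  a shorter relation for \<open>x\<close> over \<open>R\<close>, so its product with \<open>x\<close> is integral, and adding the next
  coefficient yields the next value.
\<close>

lemma partial_evaluation_closed:
  assumes ic: "integrally_closed L R" and x: "x \<in> carrier L"
  shows "set (p @ q) \<subseteq> R \<Longrightarrow> q \<noteq> [] \<Longrightarrow> eval (p @ q) x = \<zero> \<Longrightarrow> eval p x \<in> R \<and> eval p x \<otimes> x \<in> R"
proof (induction p arbitrary: q rule: rev_induct)
  case Nil
  then show ?case using x R_subringE(2) by simp
next
  case (snoc c p)
  have c: "set (p @ [c]) \<subseteq> carrier L" "set q \<subseteq> carrier L" using snoc.prems R_carr by auto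
  have e: "eval p x \<otimes> x \<in> R" using snoc.IH[of "c # q"] snoc.prems by simp
  have "eval (p @ [c]) x = eval p x \<otimes> x \<oplus> c"
    using c x by (intro eval_append_aux) auto
  also have "\<dots> \<in> R" using e snoc.prems R_subringE(7) by simp
  finally have 1: "eval (p @ [c]) x \<in> R" .
  have "eval (eval (p @ [c]) x # q) x = eval ((p @ [c]) @ q) x"
    unfolding eval_append[OF c x] by simp
  then have "eval (p @ [c]) x \<otimes> x \<in> R"
    using 1 snoc.prems by (intro leading_coeff_times_root[OF ic x, of _ q]) auto
  then show ?case using 1 by simp
qed

text \<open>
  The ring \<open>R[y]\<close>.
\<close>

definition adjoin :: "'a \<Rightarrow> 'a set" where
  "adjoin y = (\<lambda>p. eval p y) ` carrier (R[X])"

lemma adjoin_subring: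
  assumes "y \<in> carrier L" shows "subring (adjoin y) L"
proof -
  interpret h: ring_hom_ring "R[X]" L "\<lambda>p. eval p y"
    by (rule eval_ring_hom[OF R_subring assms])
  show ?thesis unfolding adjoin_def
    by (rule h.img_is_subring[OF h.R.carrier_is_subring])
qed

lemma adjoin_coeffs:
  assumes "x \<in> adjoin y" obtains p where "set p \<subseteq> R" "x = eval p y"
proof -
  obtain p where p: "polynomial\<^bsub>L\<^esub> R p" "x = eval p y"
    using assms univ_poly_carrier[of L R] unfolding adjoin_def by auto
  then have "set p \<subseteq> R" by (auto simp: polynomial_def)
  then show thesis using that p(2) by blast
qed

lemma R_subset_adjoin: "R \<subseteq> adjoin y"
proof
  fix r assume r: "r \<in> R"
  show "r \<in> adjoin y"
  proof (cases "r = \<zero>")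
    case True
    then have "r = eval [] y" by simp
    then show ?thesis unfolding adjoin_def by blast
  next
    case False
    then have "[r] \<in> carrier (R[X])"
      using r unfolding univ_poly_carrier[symmetric] polynomial_def by simp
    moreover have "r = eval [r] y" using r R_carr by simp
    ultimately show ?thesis unfolding adjoin_def by blast
  qed
qed

lemma mem_adjoin:
  assumes "y \<in> carrier L" shows "y \<in> adjoin y"
proof -
  have "[\<one>, \<zero>] \<in> carrier (R[X])"
    using R_subringE(2,3) unfolding univ_poly_carrier[symmetric] polynomial_def by simp
  moreover have "y = eval [\<one>, \<zero>] y" using assms by simp
  ultimately show ?thesis unfolding adjoin_def by blast
qed

lemma nat_pow_nonzero:
  assumes "x \<in> carrier L" "x \<noteq> \<zero>" shows "x [^] (n::nat) \<noteq> \<zero>"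
  by (induction n) (use assms integral in auto)

lemma nat_pow_in_subring:
  assumes "subring T L" "y \<in> T" shows "y [^] (n::nat) \<in> T"
  by (induction n) (use assms subringE(3,6) in auto)

lemma eval_in_subring:
  assumes "subring T L" "y \<in> T" shows "set p \<subseteq> T \<Longrightarrow> eval p y \<in> T"
  by (induction p)
    (auto intro!: subringE(2,6,7)[OF assms(1)] nat_pow_in_subring[OF assms])

text \<open>
  Splitting off the constant term \<open>a\<close> of a polynomial in \<open>y\<^bsup>n+2\<^esup>\<close> gives \<open>y = z y\<^sup>2 + a\<close> with
  \<open>z\<close> in \<open>R[y]\<close>.  In the relation \<open>z y\<^sup>2 - y + a = 0\<close>, the element \<open>z\<close> is an intermediate value of
  Horner's scheme, so \<open>z\<close> and \<open>z y\<close> lie in \<open>R\<close>.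
\<close>

lemma arithmetical_relation:
  assumes ic: "integrally_closed L R" and y: "y \<in> carrier L" "y \<noteq> \<zero>"
    and mem: "y \<in> adjoin (y [^] Suc (Suc n))"
  obtains z where "z \<in> R" "z \<otimes> y \<in> R" "(\<one> \<ominus> z \<otimes> y) \<otimes> y \<in> R"
proof -
  let ?t = "y [^] Suc (Suc n)"
  note A = adjoin_subring[OF y(1)]
  obtain p where p: "set p \<subseteq> R" "y = eval p ?t" using adjoin_coeffs[OF mem] .
  have "p \<noteq> []" using p y by auto
  then obtain p' a where pa: "p = p' @ [a]" using rev_exhaust by blast
  define w where "w = eval p' ?t"
  have a: "a \<in> R" "a \<in> carrier L" and p': "set p' \<subseteq> carrier L" using p pa R_carr by auto
  have t: "?t \<in> carrier L" using y by simp
  have wc: "w \<in> carrier L" unfolding w_def by (rule eval_in_carrier[OF p' t])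
  have yw: "y = w \<otimes> ?t \<oplus> a"
    using eval_append_aux[OF p' a(2) t] p(2) unfolding pa w_def by simp
  have "w \<otimes> y [^] n \<in> adjoin y"
  proof (rule subringE(6)[OF A])
    show "y [^] n \<in> adjoin y" by (rule nat_pow_in_subring[OF A mem_adjoin[OF y(1)]])
    have "?t \<in> adjoin y" by (rule nat_pow_in_subring[OF A mem_adjoin[OF y(1)]])
    then show "w \<in> adjoin y"
      unfolding w_def using p pa R_subset_adjoin[of y] by (intro eval_in_subring[OF A]) auto
  qed
  then obtain q where q: "set q \<subseteq> R" "w \<otimes> y [^] n = eval q y" using adjoin_coeffs by blast
  define z where "z = eval q y"
  have qc: "set q \<subseteq> carrier L" using q R_carr by auto
  have zc: "z \<in> carrier L" unfolding z_def by (rule eval_in_carrier[OF qc y(1)])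
  have nc: "y [^] n \<in> carrier L" using y by simp
  have yz: "y = (z \<otimes> y) \<otimes> y \<oplus> a"
  proof -
    have "w \<otimes> ?t = ((w \<otimes> y [^] n) \<otimes> y) \<otimes> y" using wc nc y(1) by (simp add: m_assoc)
    then show ?thesis using yw unfolding q(2) z_def by simp
  qed
  \<comment> \<open>the relation \<open>z y\<^sup>2 - y + a = 0\<close>, as a polynomial in \<open>y\<close> over \<open>R\<close>\<close>
  have "eval (q @ [\<ominus> \<one>, a]) y = (z \<otimes> y \<oplus> \<ominus> \<one>) \<otimes> y \<oplus> a"
    using eval_append_aux[of "q @ [\<ominus> \<one>]" a y] eval_append_aux[OF qc _ y(1), of "\<ominus> \<one>"] qc a y
    unfolding z_def by simp
  also have "\<dots> = ((z \<otimes> y) \<otimes> y \<oplus> a) \<ominus> y" using zc y a by algebra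
  also have "\<dots> = \<zero>" using yz y(1) by (simp add: r_neg a_minus_def)
  finally have z: "z \<in> R \<and> z \<otimes> y \<in> R"
    unfolding z_def using q(1) a R_subringE(3,5)
    by (intro partial_evaluation_closed[OF ic y(1), of _ "[\<ominus> \<one>, a]"]) auto
  have "(\<one> \<ominus> z \<otimes> y) \<otimes> y = y \<ominus> (z \<otimes> y) \<otimes> y" using zc y by algebra
  also have "\<dots> = ((z \<otimes> y) \<otimes> y \<oplus> a) \<ominus> (z \<otimes> y) \<otimes> y" using yz by simp
  also have "\<dots> = a" using zc y a by algebra
  finally show thesis using z a that by auto
qed

lemma overringsD: "T \<in> overrings L R \<Longrightarrow> subring T L" "T \<in> overrings L R \<Longrightarrow> R \<subseteq> T"
  by (auto simp: overrings_def)

text \<open>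
  Two of the rings \<open>R[x\<^bsup>2^n\<^esup>]\<close> coincide, which gives \<open>z\<close> for a power \<open>y = x\<^bsup>k+1\<^esup>\<close>.  The relation
  descends from \<open>y\<close> to \<open>x\<close> with the same \<open>s = 1 - z y\<close>, because \<open>R\<close> contains every \<open>(k+1)\<close>-th root
  of its elements and \<open>(s x)\<^bsup>k+1\<^esup> = s\<^sup>k (s y)\<close> and \<open>(z x\<^sup>k)\<^bsup>k+1\<^esup> = z (z y)\<^sup>k\<close>.
\<close>

lemma arithmetical_if_finite_overrings:
  assumes ic: "integrally_closed L R" and fin: "finite (overrings L R)"
  shows arithmetical
proof (rule arithmeticalI)
  fix x assume x: "x \<in> carrier L" "x \<noteq> \<zero>"
  let ?S = "\<lambda>n. adjoin (x [^] ((2::nat) ^ n))"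
  have "range ?S \<subseteq> overrings L R"
    using adjoin_subring R_subset_adjoin x(1) by (auto simp: overrings_def)
  then have "\<not> inj ?S"
    using fin finite_subset finite_imageD infinite_UNIV_nat by blast
  then obtain m n where mn: "m < n" "?S m = ?S n"
    unfolding inj_def by (metis linorder_neqE_nat)
  \<comment> \<open>writing the exponents as \<open>Suc k\<close> and \<open>Suc (Suc e)\<close> avoids subtraction below\<close>
  define k where "k = (2::nat) ^ m - 1"
  define y where "y = x [^] Suc k"
  have k: "Suc k = 2 ^ m" unfolding k_def by simp
  have y: "y \<in> carrier L" "y \<noteq> \<zero>"
    unfolding y_def by (rule nat_pow_closed[OF x(1)], rule nat_pow_nonzero[OF x])
  define e where "e = (2::nat) ^ (n - m) - 2"
  have "2 ^ 1 \<le> (2::nat) ^ (n - m)" using mn(1) by (intro power_increasing) auto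
  then have e: "Suc (Suc e) = 2 ^ (n - m)" unfolding e_def by simp
  have "x [^] ((2::nat) ^ n) = y [^] Suc (Suc e)"
    unfolding y_def e k nat_pow_pow[OF x(1)] using mn(1) by (simp flip: power_add)
  then have "y \<in> adjoin (y [^] Suc (Suc e))"
    using mem_adjoin[OF y(1)] mn(2) unfolding y_def k by simp
  from arithmetical_relation[OF ic y this]
  obtain z where z: "z \<in> R" "z \<otimes> y \<in> R" "(\<one> \<ominus> z \<otimes> y) \<otimes> y \<in> R" .
  define s where "s = \<one> \<ominus> z \<otimes> y"
  have s: "s \<in> R" "s \<in> carrier L" unfolding s_def using z R_minus R_subringE(3) R_carr by auto
  have zc: "z \<in> carrier L" using z R_carr by simp
  have xk: "x [^] k \<in> carrier L" using x by simp
  show "\<exists>s\<in>R. s \<otimes> x \<in> R \<and> (\<exists>d\<in>R. \<one> \<ominus> s = d \<otimes> x)"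
  proof (intro bexI conjI)
    have "(s \<otimes> x) [^] Suc k = s [^] k \<otimes> (s \<otimes> y)"
      unfolding y_def nat_pow_distrib[OF s(2) x(1)] using s x xk by (simp add: m_assoc)
    also have "\<dots> \<in> R"
      by (rule R_subringE(6)[OF nat_pow_in_subring[OF R_subring s(1)] z(3)[folded s_def]])
    finally show "s \<otimes> x \<in> R"
      by (rule root_closed[OF ic m_closed[OF s(2) x(1)]])
    have "(z \<otimes> x [^] k) [^] Suc k = z \<otimes> (z [^] k \<otimes> (x [^] k) [^] Suc k)"
      using zc x by (simp add: nat_pow_distrib m_ac)
    also have "(x [^] k) [^] Suc k = y [^] k"
      unfolding y_def nat_pow_pow[OF x(1)] by (simp add: mult.commute)
    also have "z \<otimes> (z [^] k \<otimes> y [^] k) = z \<otimes> (z \<otimes> y) [^] k"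
      using zc y by (simp add: nat_pow_distrib)
    also have "\<dots> \<in> R"
      by (intro R_subringE(6) nat_pow_in_subring[OF R_subring z(2)] z(1))
    finally show "z \<otimes> x [^] k \<in> R"
      by (rule root_closed[OF ic m_closed[OF zc xk]])
    show "\<one> \<ominus> s = (z \<otimes> x [^] k) \<otimes> x"
      unfolding s_def y_def nat_pow_Suc using zc xk x(1) by algebra
  qed (rule s)
qed

end

section \<open>Overrings of an arithmetical domain\<close>

definition downsets :: "'a::order set \<Rightarrow> 'a set set" where
  "downsets S = {D. D \<subseteq> S \<and> (\<forall>x\<in>S. \<forall>y\<in>D. x \<le> y \<longrightarrow> x \<in> D)}"

context fraction_domain
begin

definition Spec :: "'a set set" where
  "Spec = prime_ideals (L\<lparr>carrier := R\<rparr>)"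

lemma SpecD:
  assumes "P \<in> Spec"
  shows "subalgebra R P L" "P \<subseteq> R" "\<one> \<notin> P" "\<And>a b. a \<in> R \<Longrightarrow> b \<in> R \<Longrightarrow> a \<otimes> b \<in> P \<Longrightarrow> a \<in> P \<or> b \<in> P"
  using assms unfolding Spec_def prime_ideals_def primeideal_in_subring_iff[OF R_subring] mem_Collect_eq
  by blast+

lemma zero_in_Spec: "{\<zero>} \<in> Spec"
proof -
  have "subalgebra R {\<zero>} L"
    using R_carr by (auto simp: subalgebra_iff[OF R_subring])
  then show ?thesis
    using R_carr R_subringE(2) integral
    unfolding Spec_def prime_ideals_def primeideal_in_subring_iff[OF R_subring] mem_Collect_eq
    by auto
qed

text \<open>
  The localization \<open>R\<^sub>P\<close>, as a subset of the quotient field.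
\<close>

definition loc :: "'a set \<Rightarrow> 'a set" where
  "loc P = {x \<in> carrier L. \<exists>s\<in>R - P. s \<otimes> x \<in> R}"

lemma loc_overring:
  assumes "P \<in> Spec" shows "loc P \<in> overrings L R"
proof -
  note P = SpecD[OF assms]
  have mult: "s \<otimes> t \<in> R - P" if "s \<in> R - P" "t \<in> R - P" for s t
    using that P(4) R_subringE(6) by blast
  have RL: "R \<subseteq> loc P"
  proof
    fix x assume "x \<in> R"
    then have "\<one> \<otimes> x \<in> R" "x \<in> carrier L" "\<one> \<in> R - P" using R_carr P(3) R_subringE(3) by auto
    then show "x \<in> loc P" unfolding loc_def by blast
  qed
  have ops: "x \<otimes> y \<in> loc P \<and> x \<oplus> y \<in> loc P" if xy: "x \<in> loc P" "y \<in> loc P" for x y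
  proof -
    obtain s t where st: "s \<in> R - P" "s \<otimes> x \<in> R" "t \<in> R - P" "t \<otimes> y \<in> R"
      and c: "x \<in> carrier L" "y \<in> carrier L"
      using xy unfolding loc_def by blast
    have sc: "s \<in> carrier L" "t \<in> carrier L" using st R_carr by auto
    have "(s \<otimes> t) \<otimes> (x \<otimes> y) = (s \<otimes> x) \<otimes> (t \<otimes> y)" using c sc by algebra
    then have 1: "(s \<otimes> t) \<otimes> (x \<otimes> y) \<in> R" using R_subringE(6)[OF st(2,4)] by simp
    have "(s \<otimes> t) \<otimes> (x \<oplus> y) = t \<otimes> (s \<otimes> x) \<oplus> s \<otimes> (t \<otimes> y)" using c sc by algebra
    moreover have "t \<otimes> (s \<otimes> x) \<in> R" "s \<otimes> (t \<otimes> y) \<in> R" using st R_subringE(6) by auto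
    ultimately have 2: "(s \<otimes> t) \<otimes> (x \<oplus> y) \<in> R" using R_subringE(7) by simp
    show ?thesis using 1 2 mult[OF st(1,3)] c unfolding loc_def by blast
  qed
  have "\<ominus> x \<in> loc P" if "x \<in> loc P" for x
  proof -
    have "x \<in> carrier L" using that by (simp add: loc_def)
    then have "\<ominus> x = \<ominus> \<one> \<otimes> x" by algebra
    moreover have "\<ominus> \<one> \<in> loc P" using RL R_subringE(3,5) by blast
    ultimately show ?thesis using ops that by simp
  qed
  then have "subring (loc P) L"
    using ops RL R_subringE(3) by (intro subringI) (auto simp: loc_def)
  then show ?thesis using RL by (simp add: overrings_def)
qed

lemma loc_antimono: "P \<subseteq> Q \<Longrightarrow> loc Q \<subseteq> loc P"
  by (auto simp: loc_def)

lemma loc_zero: "loc {\<zero>} = carrier L"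
proof
  show "carrier L \<subseteq> loc {\<zero>}"
  proof
    fix x assume x: "x \<in> carrier L"
    obtain a b where ab: "a \<in> R" "b \<in> R - {\<zero>}" "x = a \<otimes> inv b" using R_fractions[OF x] by auto
    have c: "a \<in> carrier L" "b \<in> carrier L" "b \<noteq> \<zero>" using ab R_carr by auto
    have "b \<otimes> x = a"
      unfolding ab using c nonzero_inv[OF c(2,3)] m_lcomm[of b a "inv b"] by simp
    then show "x \<in> loc {\<zero>}" unfolding loc_def using ab x by blast
  qed
qed (auto simp: loc_def)

lemma inverse_in_loc:
  assumes "a \<in> R" "a \<noteq> \<zero>" "a \<notin> P" shows "inv a \<in> loc P"
proof -
  note i = nonzero_inv[OF R_carr[OF assms(1)] assms(2)]
  have "a \<otimes> inv a \<in> R" "a \<in> R - P" using i(2) assms R_subringE(3) by auto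
  then show ?thesis using i(1) unfolding loc_def by blast
qed

text \<open>
  An element of \<open>Q\<close> outside \<open>P\<close> is invertible in \<open>R\<^sub>P\<close> but not in \<open>R\<^sub>Q\<close>.
\<close>

lemma inj_loc: "inj_on loc Spec"
proof (rule inj_onI)
  have "Q \<subseteq> P" if PQ: "P \<in> Spec" "Q \<in> Spec" "loc P = loc Q" for P Q
  proof
    fix q assume q: "q \<in> Q"
    note P = SpecD[OF PQ(1)] and Q = SpecD[OF PQ(2)]
    have qR: "q \<in> R" "q \<in> carrier L" using q Q(2) R_carr by auto
    show "q \<in> P"
    proof (rule ccontr)
      assume n: "q \<notin> P"
      then have nz: "q \<noteq> \<zero>" using subalgebraD(2)[OF P(1)] by blast
      have "inv q \<in> loc Q" using inverse_in_loc[OF qR(1) nz n] PQ(3) by simp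
      then obtain s where s: "s \<in> R - Q" "s \<otimes> inv q \<in> R" unfolding loc_def by blast
      note i = nonzero_inv[OF qR(2) nz]
      have "s = (s \<otimes> inv q) \<otimes> q" using s R_carr i qR by (simp add: m_assoc)
      also have "\<dots> \<in> Q" using subalgebraD(4)[OF Q(1) s(2) q] .
      finally show False using s by blast
    qed
  qed
  then show "P = Q" if "P \<in> Spec" "Q \<in> Spec" "loc P = loc Q" for P Q
    using that by (metis subset_antisym)
qed

lemma finite_Spec_if_finite_overrings: "finite (overrings L R) \<Longrightarrow> finite Spec"
  using inj_on_finite[OF inj_loc] loc_overring by blast

text \<open>
  For \<open>a\<close> in \<open>P - P'\<close> and \<open>b\<close> in \<open>P' - P\<close>, the equations \<open>s a = c b\<close> and \<open>(1 - s) b = d a\<close> put \<open>s\<close>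
  into \<open>P'\<close> and \<open>1 - s\<close> into \<open>P\<close>, hence \<open>1\<close> into \<open>Q\<close>.
\<close>

lemma Spec_tree:
  assumes ar: arithmetical and S: "P \<in> Spec" "P' \<in> Spec" "Q \<in> Spec" and sub: "P \<subseteq> Q" "P' \<subseteq> Q"
  shows "P \<subseteq> P' \<or> P' \<subseteq> P"
proof (rule ccontr)
  assume "\<not> (P \<subseteq> P' \<or> P' \<subseteq> P)"
  then obtain a b where ab: "a \<in> P" "a \<notin> P'" "b \<in> P'" "b \<notin> P" by blast
  note P = SpecD[OF S(1)] and P' = SpecD[OF S(2)] and Q = SpecD[OF S(3)]
  have R: "a \<in> R" "b \<in> R" using ab P(2) P'(2) by auto
  obtain s c d where s: "s \<in> R" "c \<in> R" "d \<in> R" "s \<otimes> a = c \<otimes> b" "(\<one> \<ominus> s) \<otimes> b = d \<otimes> a"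
    using arithmeticalE[OF ar R[THEN R_carr]] .
  have sR: "\<one> \<ominus> s \<in> R" using R_minus[OF R_subringE(3) s(1)] .
  have "s \<otimes> a \<in> P'" unfolding s(4) by (rule subalgebraD(4)[OF P'(1) s(2) ab(3)])
  then have "s \<in> P'" using P'(4)[OF s(1) R(1)] ab by blast
  then have 1: "s \<in> Q" using sub by blast
  have "(\<one> \<ominus> s) \<otimes> b \<in> P" unfolding s(5) by (rule subalgebraD(4)[OF P(1) s(3) ab(1)])
  then have "\<one> \<ominus> s \<in> P" using P(4)[OF sR R(2)] ab by blast
  then have 2: "\<one> \<ominus> s \<in> Q" using sub by blast
  have "\<one> = (\<one> \<ominus> s) \<oplus> s" using R_carr[OF s(1)] by algebra
  also have "\<dots> \<in> Q" by (rule subalgebraD(3)[OF Q(1) 2 1])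
  finally show False using Q(3) by blast
qed

definition primes_below :: "'a set \<Rightarrow> 'a set set" where
  "primes_below T = {P \<in> Spec. T \<subseteq> loc P}"

text \<open>
  If \<open>x\<close> is not in \<open>T\<close>, its denominators in \<open>T\<close> form a proper ideal, which lies in a prime \<open>Q\<close>
  of \<open>T\<close>.  The prime \<open>P = Q \<inter> R\<close> satisfies \<open>T \<subseteq> R\<^sub>P\<close>: for \<open>t\<close> in \<open>T\<close>, take \<open>s t \<in> R\<close> and
  \<open>1 - s = d t\<close>; if \<open>s\<close> is in \<open>Q\<close>, then \<open>d\<close> is not, and \<open>d t\<close> is in \<open>R\<close>.  A denominator of \<open>x\<close> in
  \<open>R - P\<close> would lie in \<open>Q\<close>.
\<close>

lemma overring_eq_Inter_loc:
  assumes ar: arithmetical and T: "T \<in> overrings L R"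
  shows "T = carrier L \<inter> (\<Inter>P\<in>primes_below T. loc P)"
proof
  note Ts = overringsD[OF T] and TE = subringE[OF overringsD(1)[OF T]]
  show "T \<subseteq> carrier L \<inter> (\<Inter>P\<in>primes_below T. loc P)"
    using TE(1) by (auto simp: primes_below_def)
  show "carrier L \<inter> (\<Inter>P\<in>primes_below T. loc P) \<subseteq> T"
  proof (rule ccontr)
    assume "\<not> ?thesis"
    then obtain x where x: "x \<in> carrier L" "x \<notin> T" and xl: "\<And>P. P \<in> primes_below T \<Longrightarrow> x \<in> loc P"
      by blast
    define I where "I = {t \<in> T. t \<otimes> x \<in> T}"
    have "subalgebra T I L"
      unfolding subalgebra_iff[OF Ts(1)] I_def
      using TE(1,2) x(1) TE(6,7)
      by (auto simp: l_distr m_assoc subset_iff)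
    moreover have "\<one> \<notin> I" unfolding I_def using x by simp
    ultimately obtain Q where Q: "primeideal Q (L\<lparr>carrier := T\<rparr>)" "I \<subseteq> Q"
      using proper_ideal_subset_prime[OF Ts(1)] I_def by blast
    then have QD: "subalgebra T Q L" "Q \<subseteq> T" "\<one> \<notin> Q"
        "\<And>a b. a \<in> T \<Longrightarrow> b \<in> T \<Longrightarrow> a \<otimes> b \<in> Q \<Longrightarrow> a \<in> Q \<or> b \<in> Q"
      unfolding primeideal_in_subring_iff[OF Ts(1)] by blast+
    define P where "P = Q \<inter> R"
    have "subalgebra R P L"
      unfolding subalgebra_iff[OF R_subring] P_def
      using subalgebraD[OF QD(1)] R_subringE(2,6,7) Ts(2) R_carr by auto
    then have PS: "P \<in> Spec"
      using QD(3,4) Ts(2)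
      unfolding Spec_def prime_ideals_def primeideal_in_subring_iff[OF R_subring] mem_Collect_eq P_def
      by auto
    have "t \<in> loc P" if t: "t \<in> T" for t
    proof -
      have tc: "t \<in> carrier L" using t TE(1) by auto
      obtain s c d where s: "s \<in> R" "c \<in> R" "d \<in> R" "s \<otimes> t = c \<otimes> \<one>" "(\<one> \<ominus> s) \<otimes> \<one> = d \<otimes> t"
        using arithmeticalE[OF ar tc one_closed] .
      have sc: "s \<in> carrier L" "c \<in> carrier L" "d \<in> carrier L" using s R_carr by auto
      show ?thesis
      proof (cases "s \<in> P")
        case False
        then show ?thesis using s sc tc unfolding loc_def by auto
      next
        case True
        have dt: "d \<otimes> t = \<one> \<ominus> s" using s(5) sc by simp
        have "d \<notin> P"
        proof
          assume "d \<in> P"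
          then have "t \<otimes> d \<in> Q" using subalgebraD(4)[OF QD(1) t] unfolding P_def by blast
          then have "\<one> \<ominus> s \<in> Q" using dt tc sc by (simp add: m_comm)
          then have "(\<one> \<ominus> s) \<oplus> s \<in> Q" using subalgebraD(3)[OF QD(1)] True unfolding P_def by blast
          moreover have "(\<one> \<ominus> s) \<oplus> s = \<one>" using sc by algebra
          ultimately show False using QD(3) by simp
        qed
        moreover have "d \<otimes> t \<in> R" unfolding dt by (rule R_minus[OF R_subringE(3) s(1)])
        ultimately show ?thesis using s(3) tc unfolding loc_def by blast
      qed
    qed
    then have "P \<in> primes_below T" using PS by (auto simp: primes_below_def)
    then obtain u where u: "u \<in> R - P" "u \<otimes> x \<in> R" using xl unfolding loc_def by blast
    then have "u \<in> I" using Ts(2) unfolding I_def by blast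
    then show False using Q(2) u unfolding P_def by blast
  qed
qed

text \<open>
  Otherwise \<open>P\<close> contains a finitely generated ideal \<open>I\<close> that is contained in no \<open>Q\<close>.  Then
  \<open>(R : I)\<close> lies in every \<open>R\<^sub>Q\<close>, hence in \<open>R\<^sub>P\<close>, and \<open>1 \<in> I (R : I) \<subseteq> P R\<^sub>P\<close>, which is impossible.
\<close>

lemma prime_subset_if_Inter_loc_subset:
  assumes ar: arithmetical and P: "P \<in> Spec" and D: "finite D" "D \<noteq> {}" "D \<subseteq> Spec"
    and sub: "carrier L \<inter> (\<Inter>Q\<in>D. loc Q) \<subseteq> loc P"
  shows "\<exists>Q\<in>D. P \<subseteq> Q"
proof (rule ccontr)
  assume "\<not> ?thesis"
  then have "\<forall>Q\<in>D. \<exists>a. a \<in> P \<and> a \<notin> Q" by blast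
  then obtain f where f: "\<And>Q. Q \<in> D \<Longrightarrow> f Q \<in> P \<and> f Q \<notin> Q" by metis
  note PD = SpecD[OF P] and M = subalgebraD[OF SpecD(1)[OF P]]
  obtain Qs where Qs: "set Qs = D" using finite_list[OF D(1)] by blast
  define I where "I = Span R (map f Qs)"
  have fP: "set (map f Qs) \<subseteq> P" using f Qs by auto
  then have Us: "set (map f Qs) \<subseteq> carrier L" using M(1) by blast
  have IP: "I \<subseteq> P" unfolding I_def by (rule Span_least[OF fP PD(1)])
  have fI: "f Q \<in> I" if "Q \<in> D" for Q
    using Span_superset[OF Us] that Qs unfolding I_def by auto
  obtain Q where Q: "Q \<in> D" using D(2) by blast
  have "f Q \<noteq> \<zero>" using f[OF Q] subalgebraD(2)[OF SpecD(1)[of Q]] Q D(3) by auto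
  then have "Span R (map f Qs) \<noteq> {\<zero>}" using fI[OF Q] unfolding I_def by blast
  then have one: "\<one> \<in> I \<cdot> colon I" using one_in_prod_colon[OF ar Us] unfolding I_def by blast
  have colon: "y \<in> loc P" if y: "y \<in> colon I" for y
  proof -
    have yc: "y \<in> carrier L" using y by (simp add: colon_def)
    have "y \<in> loc Q" if Q: "Q \<in> D" for Q
    proof -
      have fQ: "f Q \<in> R - Q" using f[OF Q] PD(2) by blast
      have "y \<otimes> f Q \<in> R" using y fI[OF Q] by (simp add: colon_def)
      then have "f Q \<otimes> y \<in> R" using fQ yc R_carr by (simp add: m_comm)
      then show ?thesis using yc fQ unfolding loc_def by blast
    qed
    then show ?thesis using sub yc by blast
  qed
  have "\<exists>s\<in>R - P. s \<otimes> z \<in> P \<and> z \<in> carrier L" if "z \<in> I \<cdot> colon I" for z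
    using that
  proof induction
    case (prod i y)
    obtain s where s: "s \<in> R - P" "s \<otimes> y \<in> R" using colon[OF prod(2)] unfolding loc_def by blast
    have c: "s \<in> carrier L" "i \<in> carrier L" "y \<in> carrier L" "i \<in> P"
      using s prod IP M(1) R_carr by (auto simp: colon_def)
    have "(s \<otimes> y) \<otimes> i \<in> P" using M(4)[OF s(2) c(4)] .
    moreover have "(s \<otimes> y) \<otimes> i = s \<otimes> (i \<otimes> y)" using c(1-3) by algebra
    ultimately show ?case using s(1) c by auto
  next
    case (sum z w)
    then obtain s t where st: "s \<in> R - P" "s \<otimes> z \<in> P" "z \<in> carrier L"
      "t \<in> R - P" "t \<otimes> w \<in> P" "w \<in> carrier L" by blast
    have c: "s \<in> carrier L" "t \<in> carrier L" using st R_carr by auto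
    have "(s \<otimes> t) \<otimes> (z \<oplus> w) = t \<otimes> (s \<otimes> z) \<oplus> s \<otimes> (t \<otimes> w)" using c st(3,6) by algebra
    moreover have "t \<otimes> (s \<otimes> z) \<in> P" "s \<otimes> (t \<otimes> w) \<in> P" using M(4) st by auto
    ultimately have "(s \<otimes> t) \<otimes> (z \<oplus> w) \<in> P" using M(3) by simp
    moreover have "s \<otimes> t \<in> R - P" using st PD(4) R_subringE(6) by blast
    ultimately show ?case using st by blast
  qed
  then show False using one R_carr by force
qed

lemma bij_betw_overrings_downsets:
  assumes ar: arithmetical and fin: "finite Spec"
  shows "bij_betw primes_below (overrings L R) (downsets Spec - {{}})"
proof (rule bij_betwI')
  fix T T' assume "T \<in> overrings L R" "T' \<in> overrings L R"
  then show "primes_below T = primes_below T' \<longleftrightarrow> T = T'"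
    using overring_eq_Inter_loc[OF ar] by metis
next
  fix T assume T: "T \<in> overrings L R"
  have "T \<subseteq> carrier L" using overringsD(1)[OF T] by (rule subringE(1))
  then have "{\<zero>} \<in> primes_below T"
    using zero_in_Spec loc_zero by (auto simp: primes_below_def)
  moreover have "P \<in> primes_below T" if "P \<in> Spec" "Q \<in> primes_below T" "P \<subseteq> Q" for P Q
    using that loc_antimono[of P Q] unfolding primes_below_def by auto
  moreover have "primes_below T \<subseteq> Spec" by (auto simp: primes_below_def)
  ultimately show "primes_below T \<in> downsets Spec - {{}}"
    unfolding downsets_def by blast
next
  fix D assume D: "D \<in> downsets Spec - {{}}"
  then have DS: "D \<subseteq> Spec" "D \<noteq> {}" and cl: "\<And>P Q. P \<in> Spec \<Longrightarrow> Q \<in> D \<Longrightarrow> P \<subseteq> Q \<Longrightarrow> P \<in> D"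
    by (auto simp: downsets_def)
  have sr: "subring (loc P) L" "R \<subseteq> loc P" if "P \<in> D" for P
    using overringsD[OF loc_overring] that DS by auto
  let ?T = "\<Inter>(loc ` D)"
  have c: "?T = carrier L \<inter> (\<Inter>Q\<in>D. loc Q)" using DS(2) by (auto simp: loc_def)
  have "subring ?T L" using subring_Inter[of "loc ` D"] sr(1) DS(2) by blast
  then have T: "?T \<in> overrings L R" using sr(2) by (auto simp: overrings_def)
  have "primes_below ?T = D"
  proof (intro equalityI subsetI)
    fix P assume "P \<in> primes_below ?T"
    then have P: "P \<in> Spec" "?T \<subseteq> loc P" by (auto simp: primes_below_def)
    have "carrier L \<inter> (\<Inter>Q\<in>D. loc Q) \<subseteq> loc P" using P(2) unfolding c[symmetric] .
    from prime_subset_if_Inter_loc_subset[OF ar P(1) finite_subset[OF DS(1) fin] DS(2,1) this]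
    obtain Q where "Q \<in> D" "P \<subseteq> Q" by blast
    then show "P \<in> D" using cl[OF P(1)] by blast
  next
    fix P assume "P \<in> D"
    then show "P \<in> primes_below ?T" using DS(1) by (auto simp: primes_below_def)
  qed
  then show "\<exists>T\<in>overrings L R. D = primes_below T" using T by blast
qed

lemma maximal_ideals_eq: "maximal_ideals (L\<lparr>carrier := R\<rparr>) = {M \<in> Spec. \<forall>P\<in>Spec. M \<subseteq> P \<longrightarrow> P = M}"
proof (intro equalityI subsetI)
  interpret A: cring "L\<lparr>carrier := R\<rparr>" by (rule subring_is_cring[OF R_subring])
  fix M assume "M \<in> maximal_ideals (L\<lparr>carrier := R\<rparr>)"
  then have M: "maximalideal M (L\<lparr>carrier := R\<rparr>)" by (simp add: maximal_ideals_def)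
  have "M \<in> Spec" using A.maximalideal_prime[OF M] by (simp add: Spec_def prime_ideals_def)
  moreover have "P = M" if "P \<in> Spec" "M \<subseteq> P" for P
  proof -
    have "ideal P (L\<lparr>carrier := R\<rparr>)"
      using SpecD(1,2)[OF that(1)] ideal_in_subring_iff[OF R_subring] by blast
    then show ?thesis
      using maximalideal.I_maximal[OF M, of P] that(2) SpecD(2,3)[OF that(1)] R_subringE(3) by auto
  qed
  ultimately show "M \<in> {M \<in> Spec. \<forall>P\<in>Spec. M \<subseteq> P \<longrightarrow> P = M}" by blast
next
  fix M assume "M \<in> {M \<in> Spec. \<forall>P\<in>Spec. M \<subseteq> P \<longrightarrow> P = M}"
  then have M: "M \<in> Spec" "\<And>P. P \<in> Spec \<Longrightarrow> M \<subseteq> P \<Longrightarrow> P = M" by auto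
  have "maximalideal M (L\<lparr>carrier := R\<rparr>)"
  proof (rule maximalidealI)
    show "ideal M (L\<lparr>carrier := R\<rparr>)"
      using SpecD(1,2)[OF M(1)] ideal_in_subring_iff[OF R_subring] by blast
    show "carrier (L\<lparr>carrier := R\<rparr>) \<noteq> M" using SpecD(3)[OF M(1)] R_subringE(3) by auto
    fix J assume J: "ideal J (L\<lparr>carrier := R\<rparr>)" "M \<subseteq> J"
    then have Js: "subalgebra R J L" "J \<subseteq> R" using ideal_in_subring_iff[OF R_subring] by auto
    show "J = M \<or> J = carrier (L\<lparr>carrier := R\<rparr>)"
    proof (cases "\<one> \<in> J")
      case True
      have "x \<in> J" if "x \<in> R" for x
        using subalgebraD(4)[OF Js(1) that True] that R_carr by simp
      then show ?thesis using Js by auto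
    next
      case False
      then obtain Q where Q: "primeideal Q (L\<lparr>carrier := R\<rparr>)" "J \<subseteq> Q"
        using proper_ideal_subset_prime[OF R_subring Js] by blast
      then have "Q = M" using M(2)[of Q] J(2) by (auto simp: Spec_def prime_ideals_def)
      then show ?thesis using Q J by blast
    qed
  qed
  then show "M \<in> maximal_ideals (L\<lparr>carrier := R\<rparr>)" by (simp add: maximal_ideals_def)
qed

end

section \<open>Semistar operations of finite character\<close>

context fraction_domain
begin

abbreviation NS :: "'a set set" where
  "NS \<equiv> nonzero_submodules L R"

lemma NS_D: "E \<in> NS \<Longrightarrow> subalgebra R E L" "E \<in> NS \<Longrightarrow> \<exists>x\<in>E. x \<noteq> \<zero>"
  by (auto simp: nonzero_submodules_iff)

lemma R_submodule: "subalgebra R R L"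
  using R_subringE(1,2,6,7) unfolding subalgebra_iff[OF R_subring] by auto

lemma overring_submodule:
  assumes "T \<in> overrings L R" shows "subalgebra T T L" "subalgebra R T L"
  using subringE[OF overringsD(1)[OF assms]] overringsD(2)[OF assms]
  unfolding subalgebra_iff[OF R_subring] subalgebra_iff[OF overringsD(1)[OF assms]]
  by auto

lemma NS_superset: "F \<in> NS \<Longrightarrow> F \<subseteq> E \<Longrightarrow> subalgebra R E L \<Longrightarrow> E \<in> NS"
  unfolding nonzero_submodules_iff by blast

lemma R_in_NS: "R \<in> NS"
  using R_submodule R_subringE(3) one_not_zero unfolding nonzero_submodules_iff by blast

lemma Span_in_NS:
  assumes "set Us \<subseteq> carrier L" "\<exists>u\<in>set Us. u \<noteq> \<zero>" shows "Span R Us \<in> NS"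
  using Span_submodule[OF assms(1)] Span_superset[OF assms(1)] assms(2)
  unfolding nonzero_submodules_iff by blast

lemma principal_in_NS: "x \<in> carrier L \<Longrightarrow> x \<noteq> \<zero> \<Longrightarrow> x <# R \<in> NS"
  using Span_in_NS[of "[x]"] principal_submodule by simp

lemma scaled_in_NS:
  assumes x: "x \<in> carrier L" "x \<noteq> \<zero>" and E: "E \<in> NS" shows "x <# E \<in> NS"
proof -
  note D = subalgebraD[OF NS_D(1)[OF E]]
  have "(x \<otimes> a) \<oplus> (x \<otimes> b) \<in> x <# E" if "a \<in> E" "b \<in> E" for a b
  proof -
    have "(x \<otimes> a) \<oplus> (x \<otimes> b) = x \<otimes> (a \<oplus> b)" using that D(1) x by (intro r_distr[symmetric]) auto
    then show ?thesis using D(3)[OF that] unfolding l_coset_def by blast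
  qed
  moreover have "t \<otimes> (x \<otimes> a) \<in> x <# E" if "a \<in> E" "t \<in> R" for a t
  proof -
    have "t \<otimes> (x \<otimes> a) = x \<otimes> (t \<otimes> a)" using that D(1) R_carr x by (intro m_lcomm) auto
    then show ?thesis using D(4)[OF that(2,1)] unfolding l_coset_def by blast
  qed
  moreover have "\<zero> \<in> x <# E" using D(2) x(1) unfolding l_coset_def by (auto intro!: bexI[of _ \<zero>])
  moreover have "x <# E \<subseteq> carrier L" using D(1) x unfolding l_coset_def by auto
  ultimately have "subalgebra R (x <# E) L"
    unfolding subalgebra_iff[OF R_subring] by (auto simp: l_coset_def)
  moreover obtain e where "e \<in> E" "e \<noteq> \<zero>" using NS_D(2)[OF E] by blast
  then have "x \<otimes> e \<in> x <# E" "x \<otimes> e \<noteq> \<zero>"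
    using x D(1) integral unfolding l_coset_def by blast+
  ultimately show ?thesis unfolding nonzero_submodules_iff by blast
qed

definition extension :: "'a set \<Rightarrow> 'a set \<Rightarrow> 'a set" where
  "extension T = (\<lambda>E\<in>NS. E \<cdot> T)"

lemma prod_mono: "E \<subseteq> F \<Longrightarrow> E \<cdot> T \<subseteq> F \<cdot> T"
proof
  fix z assume EF: "E \<subseteq> F" and "z \<in> E \<cdot> T"
  from this(2) show "z \<in> F \<cdot> T"
    by induction (use EF in \<open>auto intro: ideal_prod.intros\<close>)
qed

lemma subset_prod_overring:
  assumes T: "T \<in> overrings L R" and E: "E \<subseteq> carrier L" shows "E \<subseteq> E \<cdot> T"
proof
  fix e assume e: "e \<in> E"
  have "e \<otimes> \<one> \<in> E \<cdot> T"
    using e subringE(3)[OF overringsD(1)[OF T]] by (rule ideal_prod.prod)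
  then show "e \<in> E \<cdot> T" using e E by auto
qed

lemma prod_overring_in_NS:
  assumes T: "T \<in> overrings L R" and E: "E \<in> NS"
  shows "E \<cdot> T \<in> NS" "subalgebra T (E \<cdot> T) L"
proof -
  note Es = NS_D(1)[OF E]
  show "subalgebra T (E \<cdot> T) L"
    by (rule prod_submodule[OF overringsD(1)[OF T] Es overring_submodule(1)[OF T]])
  show "E \<cdot> T \<in> NS"
    using prod_submodule[OF R_subring Es overring_submodule(2)[OF T]]
      NS_superset[OF E subset_prod_overring[OF T subalgebraD(1)[OF Es]]] by blast
qed

lemma prod_overring_least:
  assumes T: "T \<in> overrings L R" and H: "subalgebra T H L" and "E \<subseteq> H"
  shows "E \<cdot> T \<subseteq> H"
proof (rule prod_least[OF overringsD(1)[OF T] H])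
  fix x y assume xy: "x \<in> E" "y \<in> T"
  have "x \<in> carrier L" "y \<in> carrier L"
    using xy assms(3) subalgebraD(1)[OF H] subringE(1)[OF overringsD(1)[OF T]] by auto
  then show "x \<otimes> y \<in> H"
    using subalgebraD(4)[OF H xy(2), of x] xy(1) assms(3) m_comm[of x y] by auto
qed

lemma scaled_prod:
  assumes x: "x \<in> carrier L" and E: "E \<subseteq> carrier L" and T: "T \<subseteq> carrier L"
  shows "(x <# E) \<cdot> T = x <# (E \<cdot> T)"
proof
  have c: "z \<in> carrier L" if "z \<in> E \<cdot> T" for z
    using that by induction (use E T in auto)
  have "\<exists>w\<in>E \<cdot> T. z = x \<otimes> w" if "z \<in> (x <# E) \<cdot> T" for z
    using that
  proof induction
    case (prod i j)
    then obtain e where "e \<in> E" "i = x \<otimes> e" unfolding l_coset_def by blast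
    moreover have "j \<in> carrier L" "e \<in> carrier L" using prod T E calculation by auto
    ultimately show ?case using prod x ideal_prod.prod[of e E j T L] by (auto simp: m_assoc)
  next
    case (sum z w)
    then obtain z' w' where zw: "z' \<in> E \<cdot> T" "w' \<in> E \<cdot> T" "z = x \<otimes> z'" "w = x \<otimes> w'" by blast
    then have "z \<oplus> w = x \<otimes> (z' \<oplus> w')" using c x by (simp add: r_distr)
    then show ?case using ideal_prod.sum[OF zw(1,2)] by blast
  qed
  then show "(x <# E) \<cdot> T \<subseteq> x <# (E \<cdot> T)" unfolding l_coset_def by blast
  have "x \<otimes> w \<in> (x <# E) \<cdot> T" if "w \<in> E \<cdot> T" for w
    using that
  proof induction
    case (prod i j)
    have "x \<otimes> (i \<otimes> j) = (x \<otimes> i) \<otimes> j" using x E T prod by (auto simp: m_assoc subset_iff)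
    moreover have "x \<otimes> i \<in> x <# E" using prod unfolding l_coset_def by blast
    ultimately show ?case using ideal_prod.prod[OF _ prod(2)] by simp
  next
    case (sum z w)
    have "x \<otimes> (z \<oplus> w) = x \<otimes> z \<oplus> x \<otimes> w" using c sum(1,2) x by (simp add: r_distr)
    then show ?case using ideal_prod.sum[OF sum(3,4)] by simp
  qed
  then show "x <# (E \<cdot> T) \<subseteq> (x <# E) \<cdot> T" unfolding l_coset_def by blast
qed

text \<open>
  The generators include a nonzero element, because only nonzero modules are in the domain of a
  semistar operation.
\<close>

lemma prod_finitely_generated:
  assumes E: "E \<in> NS" and z: "z \<in> E \<cdot> T"
  shows "\<exists>Us. set Us \<subseteq> E \<and> (\<exists>u\<in>set Us. u \<noteq> \<zero>) \<and> z \<in> Span R Us \<cdot> T"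
  using z
proof induction
  case (prod i j)
  obtain e where e: "e \<in> E" "e \<noteq> \<zero>" using NS_D(2)[OF E] by blast
  have "set [e, i] \<subseteq> E" using e prod by simp
  moreover have "i \<in> Span R [e, i]"
    using Span_superset[of "[e, i]"] calculation subalgebraD(1)[OF NS_D(1)[OF E]] by auto
  then have "i \<otimes> j \<in> Span R [e, i] \<cdot> T" using prod(2) by (rule ideal_prod.prod)
  ultimately show ?case using e by (metis list.set_intros(1))
next
  case (sum z w)
  then obtain Us Vs where U: "set Us \<subseteq> E" "\<exists>u\<in>set Us. u \<noteq> \<zero>" "z \<in> Span R Us \<cdot> T"
    and V: "set Vs \<subseteq> E" "w \<in> Span R Vs \<cdot> T" by blast
  have c: "set (Us @ Vs) \<subseteq> carrier L" using U V subalgebraD(1)[OF NS_D(1)[OF E]] by auto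
  have "Span R Us \<subseteq> Span R (Us @ Vs)" "Span R Vs \<subseteq> Span R (Us @ Vs)"
    using Span_superset[OF c] Span_least[OF _ Span_submodule[OF c], of Us]
      Span_least[OF _ Span_submodule[OF c], of Vs] by auto
  then have "z \<in> Span R (Us @ Vs) \<cdot> T" "w \<in> Span R (Us @ Vs) \<cdot> T"
    using U(3) V(2) prod_mono by blast+
  then have "z \<oplus> w \<in> Span R (Us @ Vs) \<cdot> T" by (rule ideal_prod.sum)
  moreover have "set (Us @ Vs) \<subseteq> E" "\<exists>u\<in>set (Us @ Vs). u \<noteq> \<zero>" using U V by auto
  ultimately show ?case by blast
qed

lemma extension_in_SSFc:
  assumes T: "T \<in> overrings L R" shows "extension T \<in> SSFc L R"
proof -
  have Tc: "T \<subseteq> carrier L" using subringE(1)[OF overringsD(1)[OF T]] .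
  have [simp]: "extension T E = E \<cdot> T" if "E \<in> NS" for E
    using that by (simp add: extension_def)
  have c: "E \<subseteq> carrier L" if "E \<in> NS" for E using subalgebraD(1)[OF NS_D(1)[OF that]] .
  have sub: "E \<subseteq> E \<cdot> T" if "E \<in> NS" for E
    by (rule subset_prod_overring[OF T c[OF that]])
  note NS' = prod_overring_in_NS[OF T]
  have "semistar_operation L R (extension T)"
    unfolding semistar_operation_def
  proof (intro conjI ballI impI)
    show "extension T \<in> NS \<rightarrow>\<^sub>E NS" using NS'(1) by (auto simp: extension_def)
  next
    fix x E assume x: "x \<in> carrier L - {\<zero>}" and E: "E \<in> NS"
    then show "extension T (x <# E) = x <# extension T E"
      using scaled_in_NS scaled_prod[OF _ c Tc] by auto
  next
    fix E assume E: "E \<in> NS"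
    then show "E \<subseteq> extension T E" using sub by simp
    have "(E \<cdot> T) \<cdot> T \<subseteq> E \<cdot> T"
      by (rule prod_overring_least[OF T NS'(2)[OF E] subset_refl])
    then show "extension T (extension T E) = extension T E"
      using E NS'(1)[OF E] sub[OF NS'(1)[OF E]] by auto
  next
    fix E F assume "E \<in> NS" "F \<in> NS" "E \<subseteq> F"
    then show "extension T E \<subseteq> extension T F" using prod_mono by simp
  qed
  moreover have "finite_character L R (extension T)"
    unfolding finite_character_def
  proof (intro ballI equalityI subsetI)
    fix E z assume E: "E \<in> NS" and "z \<in> extension T E"
    then have "z \<in> E \<cdot> T" by simp
    from prod_finitely_generated[OF E this]
    obtain Us where U: "set Us \<subseteq> E" "\<exists>u\<in>set Us. u \<noteq> \<zero>" "z \<in> Span R Us \<cdot> T" by blast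
    have Uc: "set Us \<subseteq> carrier L" using U c[OF E] by blast
    have F: "Span R Us \<in> NS" by (rule Span_in_NS[OF Uc U(2)])
    have "finitely_generated L R (Span R Us)" using Uc unfolding finitely_generated_def by blast
    moreover have "Span R Us \<subseteq> E" by (rule Span_least[OF U(1) NS_D(1)[OF E]])
    moreover have "z \<in> extension T (Span R Us)" using U(3) F by simp
    ultimately show "z \<in> \<Union> {extension T F | F. F \<in> NS \<and> finitely_generated L R F \<and> F \<subseteq> E}"
      using F by blast
  next
    fix E z assume E: "E \<in> NS"
      and "z \<in> \<Union> {extension T F | F. F \<in> NS \<and> finitely_generated L R F \<and> F \<subseteq> E}"
    then obtain F where "F \<in> NS" "F \<subseteq> E" "z \<in> extension T F" by blast
    then show "z \<in> extension T E" using prod_mono[of F E T] E by auto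
  qed
  ultimately show ?thesis by (simp add: SSFc_def)
qed

lemma R_prod_overring:
  assumes T: "T \<in> overrings L R" shows "R \<cdot> T = T"
proof
  show "R \<cdot> T \<subseteq> T"
    by (rule prod_overring_least[OF T overring_submodule(1)[OF T] overringsD(2)[OF T]])
  show "T \<subseteq> R \<cdot> T"
  proof
    fix t assume t: "t \<in> T"
    have "\<one> \<otimes> t \<in> R \<cdot> T" using R_subringE(3) t by (rule ideal_prod.prod)
    then show "t \<in> R \<cdot> T" using t subringE(1)[OF overringsD(1)[OF T]] by auto
  qed
qed

lemma inj_extension: "inj_on extension (overrings L R)"
proof (rule inj_onI)
  fix T T' assume "T \<in> overrings L R" "T' \<in> overrings L R" "extension T = extension T'"
  then show "T = T'"
    using R_prod_overring R_in_NS by (metis extension_def restrict_apply')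
qed

lemma semistarD:
  assumes "semistar_operation L R s"
  shows "E \<in> NS \<Longrightarrow> s E \<in> NS" "E \<in> NS \<Longrightarrow> E \<subseteq> s E" "E \<in> NS \<Longrightarrow> s (s E) = s E"
    "x \<in> carrier L \<Longrightarrow> x \<noteq> \<zero> \<Longrightarrow> E \<in> NS \<Longrightarrow> s (x <# E) = x <# s E"
    "E \<in> NS \<Longrightarrow> F \<in> NS \<Longrightarrow> E \<subseteq> F \<Longrightarrow> s E \<subseteq> s F" "s \<in> extensional NS"
  using assms unfolding semistar_operation_def by (auto simp: PiE_def)

lemma scaled_subset: "subalgebra R E L \<Longrightarrow> x \<in> E \<Longrightarrow> x <# R \<subseteq> E"
  using subalgebraD(1,4)[of R E] R_carr m_comm[of x] unfolding l_coset_def by auto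

text \<open>
  For \<open>x\<close> in \<open>R\<^sup>*\<close>, one has \<open>x R\<^sup>* = (x R)\<^sup>* \<subseteq> (R\<^sup>*)\<^sup>* = R\<^sup>*\<close>, so \<open>R\<^sup>*\<close> is closed under products.
\<close>

lemma semistar_R_overring:
  assumes s: "semistar_operation L R s" shows "s R \<in> overrings L R"
proof -
  note S = semistarD[OF s]
  have NSsR: "s R \<in> NS" using S(1) R_in_NS .
  note D = subalgebraD[OF NS_D(1)[OF NSsR]]
  have Rs: "R \<subseteq> s R" using S(2) R_in_NS .
  have "x \<otimes> y \<in> s R" if x: "x \<in> s R" and y: "y \<in> s R" for x y
  proof (cases "x = \<zero>")
    case True
    then show ?thesis using D(1,2) y by auto
  next
    case False
    have xc: "x \<in> carrier L" using x D(1) by auto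
    have "x <# s R = s (x <# R)" using S(4)[OF xc False R_in_NS] by simp
    also have "\<dots> \<subseteq> s (s R)"
      using S(5)[OF principal_in_NS[OF xc False] NSsR scaled_subset[OF NS_D(1)[OF NSsR] x]] .
    also have "\<dots> = s R" using S(3)[OF R_in_NS] .
    finally show ?thesis using y unfolding l_coset_def by auto
  qed
  then have "subring (s R) L"
    using D Rs R_subringE(3) by (intro subringI) auto
  then show ?thesis using Rs by (simp add: overrings_def)
qed

text \<open>
  Write \<open>1\<close> as a sum of products \<open>i j\<close> with \<open>i\<close> in \<open>F\<close> and \<open>j\<close> in \<open>(R : F)\<close>.  For \<open>y\<close> in \<open>F\<^sup>*\<close>, each
  \<open>j y\<close> lies in \<open>(j F)\<^sup>* \<subseteq> R\<^sup>*\<close>, so \<open>y\<close> is a sum of elements \<open>i (j y)\<close> of \<open>F R\<^sup>*\<close>.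
\<close>

lemma semistar_finitely_generated:
  assumes ar: arithmetical and s: "semistar_operation L R s"
    and Us: "set Us \<subseteq> carrier L" and F: "F = Span R Us" "F \<in> NS"
  shows "s F = F \<cdot> s R"
proof
  note S = semistarD[OF s]
  note T = semistar_R_overring[OF s]
  note D = subalgebraD[OF NS_D(1)[OF F(2)]]
  note DT = subalgebraD[OF overring_submodule(2)[OF T]]
  note sF = S(1)[OF F(2)]
  note DF = subalgebraD[OF NS_D(1)[OF sF]]
  have sc: "x <# s R \<subseteq> s F" if x: "x \<in> F" "x \<noteq> \<zero>" for x
  proof -
    have xc: "x \<in> carrier L" using x D(1) by auto
    have "x <# s R = s (x <# R)" using S(4)[OF xc x(2) R_in_NS] by simp
    also have "\<dots> \<subseteq> s F"
      using S(5)[OF principal_in_NS[OF xc x(2)] F(2) scaled_subset[OF NS_D(1)[OF F(2)] x(1)]] .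
    finally show ?thesis .
  qed
  show "F \<cdot> s R \<subseteq> s F"
  proof (rule prod_least[OF R_subring NS_D(1)[OF sF]])
    fix x y assume xy: "x \<in> F" "y \<in> s R"
    show "x \<otimes> y \<in> s F"
    proof (cases "x = \<zero>")
      case True
      then show ?thesis using xy DF(2) DT(1) by auto
    next
      case False
      then show ?thesis using sc[OF xy(1)] xy(2) unfolding l_coset_def by auto
    qed
  qed
  show "s F \<subseteq> F \<cdot> s R"
  proof
    fix y assume y: "y \<in> s F"
    have yc: "y \<in> carrier L" using y DF(1) by auto
    note M = subalgebraD[OF NS_D(1)[OF prod_overring_in_NS(1)[OF T F(2)]]]
    have colon: "j \<otimes> y \<in> s R" if j: "j \<in> colon F" for j
    proof (cases "j = \<zero>")
      case True
      then show ?thesis using yc DT(2) by simp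
    next
      case False
      have jc: "j \<in> carrier L" using j by (simp add: colon_def)
      have "j <# F \<subseteq> R" using j by (auto simp: colon_def l_coset_def)
      then have "s (j <# F) \<subseteq> s R"
        using S(5)[OF scaled_in_NS[OF jc False F(2)] R_in_NS] by blast
      then show ?thesis using S(4)[OF jc False F(2)] y unfolding l_coset_def by auto
    qed
    have "z \<otimes> y \<in> F \<cdot> s R \<and> z \<in> carrier L" if "z \<in> F \<cdot> colon F" for z
      using that
    proof induction
      case (prod i j)
      have c: "i \<in> carrier L" "j \<in> carrier L" using prod D(1) by (auto simp: colon_def)
      have "i \<otimes> (j \<otimes> y) \<in> F \<cdot> s R" using prod(1) colon[OF prod(2)] by (rule ideal_prod.prod)
      then show ?case using c yc by (simp add: m_assoc)
    next
      case (sum z w)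
      then have "(z \<oplus> w) \<otimes> y = z \<otimes> y \<oplus> w \<otimes> y" using yc by (simp add: l_distr)
      then show ?case using M(3) sum by simp
    qed
    moreover have "F \<noteq> {\<zero>}" using NS_D(2)[OF F(2)] by auto
    then have "\<one> \<in> F \<cdot> colon F" using one_in_prod_colon[OF ar Us] F(1) by simp
    ultimately have "\<one> \<otimes> y \<in> F \<cdot> s R" by blast
    then show "y \<in> F \<cdot> s R" using yc by simp
  qed
qed

text \<open>
  Both operations have finite character, so it is enough that they agree on finitely generated
  modules.
\<close>

lemma SSFc_is_extension:
  assumes ar: arithmetical and s: "s \<in> SSFc L R" shows "s = extension (s R)"
proof -
  have ss: "semistar_operation L R s" and fs: "finite_character L R s"
    using s by (auto simp: SSFc_def)
  note T = semistar_R_overring[OF ss]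
  have fT: "finite_character L R (extension (s R))"
    using extension_in_SSFc[OF T] by (simp add: SSFc_def)
  have eq: "s F = extension (s R) F" if "F \<in> NS" "finitely_generated L R F" for F
    using that semistar_finitely_generated[OF ar ss] unfolding finitely_generated_def extension_def
    by auto
  have "s E = extension (s R) E" if E: "E \<in> NS" for E
  proof -
    have "{s F | F. F \<in> NS \<and> finitely_generated L R F \<and> F \<subseteq> E} =
        {extension (s R) F | F. F \<in> NS \<and> finitely_generated L R F \<and> F \<subseteq> E}"
      by (intro Collect_cong ex_cong1) (auto simp: eq)
    then show ?thesis
      using bspec[OF fs[unfolded finite_character_def] E] bspec[OF fT[unfolded finite_character_def] E]
      by simp
  qed
  then show ?thesis
    using semistarD(6)[OF ss] by (intro extensionalityI[of _ NS]) (auto simp: extension_def)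
qed

lemma bij_betw_overrings_SSFc:
  assumes ar: arithmetical shows "bij_betw extension (overrings L R) (SSFc L R)"
  unfolding bij_betw_def
proof (intro conjI equalityI subsetI inj_extension)
  show "s \<in> SSFc L R" if "s \<in> extension ` overrings L R" for s
    using that extension_in_SSFc by blast
  show "s \<in> extension ` overrings L R" if "s \<in> SSFc L R" for s
  proof -
    have "s R \<in> overrings L R"
      using that by (intro semistar_R_overring) (auto simp: SSFc_def)
    then show ?thesis using SSFc_is_extension[OF ar that] by blast
  qed
qed

lemma finite_overrings_if_finite_SSFc: "finite (SSFc L R) \<Longrightarrow> finite (overrings L R)"
  using inj_on_finite[OF inj_extension] extension_in_SSFc by blast

end

section \<open>Counting downsets along a longest chain\<close>

lemma in_downsetsD:
  "D \<in> downsets S \<Longrightarrow> D \<subseteq> S" "D \<in> downsets S \<Longrightarrow> x \<in> S \<Longrightarrow> y \<in> D \<Longrightarrow> x \<le> y \<Longrightarrow> x \<in> D"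
  by (auto simp: downsets_def)

lemma finite_downsets: "finite S \<Longrightarrow> finite (downsets S)"
  by (rule finite_subset[of _ "Pow S"]) (auto simp: downsets_def)

lemma downsets_singleton: "downsets {a::'a::order} - {{}} = {{a}}"
  by (auto simp: downsets_def)

lemma downsets_doubleton_less: "a < b \<Longrightarrow> downsets {a, b::'a::order} - {{}} = {{a}, {a, b}}"
proof (intro equalityI subsetI)
  fix D assume ab: "a < b" and D: "D \<in> downsets {a, b} - {{}}"
  then have "D \<subseteq> {a, b}" "D \<noteq> {}" "b \<in> D \<Longrightarrow> a \<in> D"
    using in_downsetsD[of D "{a, b}"] by auto
  then show "D \<in> {{a}, {a, b}}" by blast
qed (auto simp: downsets_def)

lemma downsets_doubleton_incomparable:
  "\<not> a \<le> b \<Longrightarrow> \<not> b \<le> a \<Longrightarrow> downsets {a, b::'a::order} - {{}} = {{a}, {b}, {a, b}}"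
proof (intro equalityI subsetI)
  fix D assume "D \<in> downsets {a, b} - {{}}"
  then have "D \<subseteq> {a, b}" "D \<noteq> {}" by (auto simp: downsets_def)
  then show "D \<in> {{a}, {b}, {a, b}}" by blast
qed (auto simp: downsets_def)

text \<open>
  The spectrum of a Pruefer domain of dimension \<open>r\<close> has this form.  Counting relative to one longest
  chain avoids recursion over the branches of the tree: a downset is an initial segment of the chain
  together with a downset of the remaining elements.
\<close>

locale tree_with_longest_chain =
  fixes S :: "'b::order set" and P :: "nat \<Rightarrow> 'b" and r :: nat
  assumes finite_S: "finite S"
    and chain_mem: "i \<le> r \<Longrightarrow> P i \<in> S"
    and chain_step: "i < r \<Longrightarrow> P i < P (Suc i)"
    and bottom: "x \<in> S \<Longrightarrow> P 0 \<le> x"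
    and tree: "\<lbrakk>x \<in> S; y \<in> S; z \<in> S; x \<le> z; y \<le> z\<rbrakk> \<Longrightarrow> x \<le> y \<or> y \<le> x"
    and longest: "\<not> (\<exists>Q. (\<forall>i\<le>Suc r. Q i \<in> S) \<and> (\<forall>i<Suc r. Q i < Q (Suc i)))"
begin

lemma chain_less: "i < j \<Longrightarrow> j \<le> r \<Longrightarrow> P i < P j"
proof (induction j)
  case (Suc j)
  then have "P j < P (Suc j)" using chain_step by simp
  then show ?case using Suc by (cases "i = j") (auto intro: less_trans)
qed simp

lemma chain_le_iff: "i \<le> r \<Longrightarrow> j \<le> r \<Longrightarrow> P i \<le> P j \<longleftrightarrow> i \<le> j"
  using chain_less[of i j] chain_less[of j i] by (cases i j rule: linorder_cases) auto

text \<open>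
  This covers all refinements of the chain: \<open>e\<close> becomes its \<open>k\<close>-th element, in front for
  \<open>k = 0\<close> and at the end for \<open>k = Suc r\<close>.
\<close>

lemma no_insertion:
  assumes "k \<le> Suc r" "e \<in> S" "0 < k \<Longrightarrow> P (k - 1) < e" "k \<le> r \<Longrightarrow> e < P k"
  shows False
proof -
  define Q where "Q i = (if i < k then P i else if i = k then e else P (i - 1))" for i
  have "Q i \<in> S" if "i \<le> Suc r" for i
    using that assms(1,2) chain_mem by (auto simp: Q_def)
  moreover have "Q i < Q (Suc i)" if "i < Suc r" for i
  proof -
    consider "Suc i < k" | "Suc i = k" | "i = k" | "k < i" by linarith
    then show ?thesis
    proof cases
      case 1 then show ?thesis using chain_step[of i] assms(1) by (simp add: Q_def)
    next
      case 2 then show ?thesis using assms(3) by (auto simp: Q_def)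
    next
      case 3 then show ?thesis using assms(4) that by (auto simp: Q_def)
    next
      case 4 then show ?thesis using chain_step[of "i - 1"] that by (auto simp: Q_def)
    qed
  qed
  ultimately show False using longest by blast
qed

definition off_chain :: "'b set" where
  "off_chain = S - P ` {..r}"

lemma finite_off_chain: "finite off_chain"
  using finite_S by (simp add: off_chain_def)

lemma not_le_top:
  assumes "e \<in> off_chain" shows "\<not> e \<le> P r"
proof
  assume le: "e \<le> P r"
  have e: "e \<in> S" "\<And>i. i \<le> r \<Longrightarrow> e \<noteq> P i" using assms by (auto simp: off_chain_def)
  define k where "k = (LEAST i. i \<le> r \<and> e \<le> P i)"
  have k: "k \<le> r" "e \<le> P k" using LeastI[of "\<lambda>i. i \<le> r \<and> e \<le> P i" r] le by (auto simp: k_def)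
  show False
  proof (rule no_insertion[of k e])
    assume "0 < k"
    then have "\<not> e \<le> P (k - 1)"
      using not_less_Least[of "k - 1" "\<lambda>i. i \<le> r \<and> e \<le> P i"] k(1) by (auto simp: k_def)
    moreover have "P (k - 1) \<le> P r" using k(1) by (simp add: chain_le_iff)
    ultimately have "P (k - 1) \<le> e"
      using tree[of e "P (k - 1)" "P r"] e(1) le chain_mem k(1) by auto
    moreover have "P (k - 1) \<noteq> e" using e(2)[OF le_trans[OF diff_le_self k(1)]] by blast
    ultimately show "P (k - 1) < e" by (simp add: less_le)
  qed (use k e in \<open>auto simp: less_le\<close>)
qed

text \<open>
  \<open>P j\<close> is the place where the branch of \<open>e\<close> leaves the chain; \<open>j < r\<close> because nothing lies above
  \<open>P r\<close>.
\<close>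

lemma attachment:
  assumes "e \<in> off_chain" obtains j where "j < r" "\<And>i. i \<le> r \<Longrightarrow> P i \<le> e \<longleftrightarrow> i \<le> j"
proof -
  have e: "e \<in> S" "e \<noteq> P r" using assms by (auto simp: off_chain_def)
  have 0: "P 0 \<le> e" using bottom[OF e(1)] .
  have top: "\<not> P r \<le> e"
    using no_insertion[of "Suc r" e] e by (auto simp: less_le)
  define j where "j = Max {i. i \<le> r \<and> P i \<le> e}"
  have fin: "finite {i. i \<le> r \<and> P i \<le> e}" by simp
  have "j \<in> {i. i \<le> r \<and> P i \<le> e}"
    unfolding j_def using 0 by (intro Max_in fin) auto
  then have j: "j \<le> r" "P j \<le> e" by auto
  have "P i \<le> e \<longleftrightarrow> i \<le> j" if "i \<le> r" for i
  proof
    assume "P i \<le> e" then show "i \<le> j" unfolding j_def using that by (intro Max_ge fin) auto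
  next
    assume "i \<le> j"
    then have "P i \<le> P j" using that j by (simp add: chain_le_iff)
    then show "P i \<le> e" using j by simp
  qed
  moreover have "j < r" using j top by (cases "j = r") auto
  ultimately show thesis using that by blast
qed

text \<open>
  The \<open>m\<close> for which \<open>P 0, \<dots>, P m\<close> together with the downset \<open>F\<close> of \<open>off_chain\<close> form a downset
  of \<open>S\<close>.
\<close>

definition cuts :: "'b set \<Rightarrow> nat set" where
  "cuts F = {m. m \<le> r \<and> (\<forall>e\<in>F. \<forall>i\<le>r. P i \<le> e \<longrightarrow> i \<le> m)}"

lemma finite_cuts: "finite (cuts F)"
  by (rule finite_subset[of _ "{..r}"]) (auto simp: cuts_def)

lemma cuts_eq:
  assumes "e \<in> F" "j \<le> r" "P j \<le> e" "\<And>x i. x \<in> F \<Longrightarrow> i \<le> r \<Longrightarrow> P i \<le> x \<Longrightarrow> i \<le> j"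
  shows "cuts F = {j..r}"
  using assms unfolding cuts_def by fastforce

text \<open>
  Every branch leaves the chain before \<open>P r\<close>, so the segments up to \<open>P (r - 1)\<close> and up to \<open>P r\<close>
  both qualify.
\<close>

lemma two_le_card_cuts:
  assumes "F \<subseteq> off_chain" "F \<noteq> {}" shows "2 \<le> card (cuts F)"
proof -
  have lt: "i < r" if "e \<in> F" "i \<le> r" "P i \<le> e" for e i
  proof -
    obtain j where "j < r" "\<And>i. i \<le> r \<Longrightarrow> P i \<le> e \<longleftrightarrow> i \<le> j"
      using attachment[of e] \<open>e \<in> F\<close> assms(1) by blast
    then show ?thesis using that(2,3) by fastforce
  qed
  obtain e where e: "e \<in> F" using assms(2) by blast
  have "P 0 \<le> e" using e assms(1) by (intro bottom) (auto simp: off_chain_def)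
  then have r: "0 < r" using lt[OF e] by blast
  have "m \<in> cuts F" if "m = r - 1 \<or> m = r" for m
    using that lt unfolding cuts_def by fastforce
  then have "{r - 1, r} \<subseteq> cuts F" by blast
  then have "card {r - 1, r} \<le> card (cuts F)" by (rule card_mono[OF finite_cuts])
  then show ?thesis using r by simp
qed

text \<open>
  A nonempty downset contains the least element \<open>P 0\<close>, so it has a largest chain element \<open>P m\<close>.
  No element off the chain lies below a chain element, so \<open>m\<close> is restricted only from below, by
  the elements off the chain.  The empty \<open>F\<close> contributes \<open>Suc r\<close>.
\<close>

lemma card_downsets:
  "card (downsets S - {{}}) = Suc r + (\<Sum>F\<in>downsets off_chain - {{}}. card (cuts F))"
proof -
  let ?f = "\<lambda>(F, m). P ` {..m} \<union> F"
  have chain_iff: "P i \<in> P ` {..m} \<longleftrightarrow> i \<le> m" if "i \<le> r" "m \<le> r" for i m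
    using that chain_le_iff by (auto simp: image_iff intro: antisym) (metis antisym le_trans order_refl)
  have disj: "P i \<notin> F" if "F \<subseteq> off_chain" "i \<le> r" for F i using that by (auto simp: off_chain_def)
  have "bij_betw ?f (SIGMA F:downsets off_chain. cuts F) (downsets S - {{}})"
  proof (rule bij_betwI')
    fix x y assume "x \<in> (SIGMA F:downsets off_chain. cuts F)" "y \<in> (SIGMA F:downsets off_chain. cuts F)"
    then obtain F m F' m' where xy: "x = (F, m)" "y = (F', m')" "F \<subseteq> off_chain" "F' \<subseteq> off_chain" "m \<le> r" "m' \<le> r"
      by (auto simp: downsets_def cuts_def)
    show "?f x = ?f y \<longleftrightarrow> x = y"
    proof
      assume eq: "?f x = ?f y"
      have "P ` {..m} \<inter> off_chain = {}" "P ` {..m'} \<inter> off_chain = {}" using xy by (auto simp: off_chain_def)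
      then have "?f x \<inter> off_chain = F" "?f y \<inter> off_chain = F'" using xy by auto
      then have "F = F'" using eq by simp
      moreover have "P m \<in> ?f y" "P m' \<in> ?f x" using eq xy by auto
      then have "m \<le> m'" "m' \<le> m" using xy chain_iff disj by auto
      ultimately show "x = y" using xy by simp
    qed simp
  next
    fix x assume "x \<in> (SIGMA F:downsets off_chain. cuts F)"
    then obtain F m where x: "x = (F, m)" "F \<in> downsets off_chain" "m \<in> cuts F" by blast
    note F = in_downsetsD[OF x(2)]
    have m: "m \<le> r" "\<And>e i. e \<in> F \<Longrightarrow> i \<le> r \<Longrightarrow> P i \<le> e \<Longrightarrow> i \<le> m" using x(3) by (auto simp: cuts_def)
    have "a \<in> ?f x" if a: "a \<in> S" "b \<in> ?f x" "a \<le> b" for a b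
    proof (cases "a \<in> off_chain")
      case True
      have "b \<in> F"
      proof (rule ccontr)
        assume "b \<notin> F"
        then obtain i where "b = P i" "i \<le> m" using a x by auto
        then have "b \<le> P r" using m by (simp add: chain_le_iff)
        then show False using not_le_top[OF True] a(3) by auto
      qed
      then show ?thesis using F(2)[OF True _ a(3)] x by auto
    next
      case False
      then obtain i where i: "a = P i" "i \<le> r" using a by (auto simp: off_chain_def)
      have "i \<le> m"
      proof (cases "b \<in> F")
        case True then show ?thesis using m(2) i a(3) by blast
      next
        case False
        then obtain k where "b = P k" "k \<le> m" using a x by auto
        then show ?thesis using a(3) i m(1) by (auto simp: chain_le_iff)
      qed
      then show ?thesis using x i by auto
    qed
    moreover have "?f x \<subseteq> S" using x F(1) m chain_mem by (auto simp: off_chain_def)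
    moreover have "?f x \<noteq> {}" using x by auto
    ultimately show "?f x \<in> downsets S - {{}}" unfolding downsets_def by blast
  next
    fix D assume D: "D \<in> downsets S - {{}}"
    then have DS: "D \<subseteq> S" "D \<noteq> {}" and cl: "\<And>x y. x \<in> S \<Longrightarrow> y \<in> D \<Longrightarrow> x \<le> y \<Longrightarrow> x \<in> D"
      by (auto simp: downsets_def)
    obtain d where "d \<in> D" using DS by blast
    then have 0: "P 0 \<in> D" using cl[OF chain_mem[of 0]] bottom DS by auto
    define m where "m = Max {i. i \<le> r \<and> P i \<in> D}"
    have fin: "finite {i. i \<le> r \<and> P i \<in> D}" by simp
    have "m \<in> {i. i \<le> r \<and> P i \<in> D}" unfolding m_def using 0 by (intro Max_in fin) auto
    then have m: "m \<le> r" "P m \<in> D" by auto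
    have le: "i \<le> m" if "i \<le> r" "P i \<in> D" for i
      unfolding m_def using that by (intro Max_ge fin) auto
    have ge: "P i \<in> D" if "i \<le> m" for i
      using cl[OF chain_mem m(2)] that m(1) by (simp add: chain_le_iff)
    have "D = P ` {..m} \<union> (D \<inter> off_chain)"
    proof (intro equalityI subsetI)
      fix x assume x: "x \<in> D"
      show "x \<in> P ` {..m} \<union> (D \<inter> off_chain)"
      proof (cases "x \<in> off_chain")
        case False
        then obtain i where "x = P i" "i \<le> r" using x DS by (auto simp: off_chain_def)
        then show ?thesis using le x by auto
      qed (use x in simp)
    qed (use ge in auto)
    moreover have "D \<inter> off_chain \<in> downsets off_chain" using cl by (auto simp: downsets_def off_chain_def)
    moreover have "m \<in> cuts (D \<inter> off_chain)"
      using m(1) le cl chain_mem unfolding cuts_def by blast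
    ultimately show "\<exists>x\<in>SIGMA F:downsets off_chain. cuts F. D = ?f x"
      by (intro bexI[of _ "(D \<inter> off_chain, m)"]) auto
  qed
  then have "card (downsets S - {{}}) = card (SIGMA F:downsets off_chain. cuts F)"
    by (simp add: bij_betw_same_card)
  also have "\<dots> = (\<Sum>F\<in>downsets off_chain. card (cuts F))"
    using finite_downsets[OF finite_off_chain] finite_cuts by simp
  also have "\<dots> = card (cuts {}) + (\<Sum>F\<in>downsets off_chain - {{}}. card (cuts F))"
    by (rule sum.remove[OF finite_downsets[OF finite_off_chain]]) (simp add: downsets_def)
  also have "card (cuts {}) = Suc r"
  proof -
    have "cuts {} = {..r}" by (auto simp: cuts_def)
    then show ?thesis by simp
  qed
  finally show ?thesis .
qed

lemma card_cuts_of_attachment: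
  assumes "e \<in> F" "j < r" "\<And>i. i \<le> r \<Longrightarrow> P i \<le> e \<longleftrightarrow> i \<le> j"
    and "\<And>x i. x \<in> F \<Longrightarrow> i \<le> r \<Longrightarrow> P i \<le> x \<Longrightarrow> i \<le> j"
  shows "card (cuts F) = Suc r - j"
proof -
  have "cuts F = {j..r}"
    using assms by (intro cuts_eq[of e]) auto
  then show ?thesis by simp
qed

text \<open>
  A chain element below \<open>b\<close> is comparable with \<open>a\<close> in a tree, and it cannot lie above \<open>a\<close>.
\<close>

lemma same_attachment:
  assumes ab: "a \<in> off_chain" "b \<in> off_chain" "a \<le> b" and i: "i \<le> r"
  shows "P i \<le> b \<longleftrightarrow> P i \<le> a"
proof
  assume "P i \<le> b"
  then consider "P i \<le> a" | "a \<le> P i"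
    using tree[of "P i" a b] ab chain_mem[OF i] by (auto simp: off_chain_def)
  then show "P i \<le> a"
  proof cases
    case 2
    have "P i \<le> P r" using i by (simp add: chain_le_iff)
    then show ?thesis using not_le_top[OF ab(1)] 2 by (meson order_trans)
  qed
next
  assume "P i \<le> a" then show "P i \<le> b" using ab(3) by (rule order_trans)
qed

lemma no_two_above:
  assumes "1 \<le> r" "P (r - 1) < a" "a < b" "a \<in> S" "b \<in> S"
  shows False
proof -
  define Q where "Q i = (if i < r then P i else if i = r then a else b)" for i
  have "\<forall>i\<le>Suc r. Q i \<in> S" using chain_mem assms(4,5) by (auto simp: Q_def)
  moreover have "Q i < Q (Suc i)" if "i < Suc r" for i
  proof -
    consider "Suc i < r" | "i = r - 1" "Suc i = r" | "i = r" using \<open>i < Suc r\<close> by linarith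
    then show ?thesis
      by cases (use chain_step[of i] assms in \<open>auto simp: Q_def\<close>)
  qed
  ultimately show False using longest by blast
qed

lemma maximal_elements:
  "{x \<in> S. \<forall>y\<in>S. x \<le> y \<longrightarrow> y = x} = insert (P r) {x \<in> off_chain. \<forall>y\<in>off_chain. x \<le> y \<longrightarrow> y = x}"
proof (intro equalityI subsetI)
  fix x assume x: "x \<in> {x \<in> S. \<forall>y\<in>S. x \<le> y \<longrightarrow> y = x}"
  show "x \<in> insert (P r) {x \<in> off_chain. \<forall>y\<in>off_chain. x \<le> y \<longrightarrow> y = x}"
  proof (cases "x \<in> off_chain")
    case True then show ?thesis using x by (auto simp: off_chain_def)
  next
    case False
    then obtain i where i: "x = P i" "i \<le> r" using x by (auto simp: off_chain_def)
    then have "x \<le> P r" by (simp add: chain_le_iff)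
    then show ?thesis using x chain_mem[of r] by auto
  qed
next
  fix x assume x: "x \<in> insert (P r) {x \<in> off_chain. \<forall>y\<in>off_chain. x \<le> y \<longrightarrow> y = x}"
  have "y = x" if y: "y \<in> S" "x \<le> y" for y
  proof (cases "y \<in> off_chain")
    case True
    have "x \<noteq> P r"
    proof
      assume "x = P r"
      moreover obtain j where "j < r" "\<And>i. i \<le> r \<Longrightarrow> P i \<le> y \<longleftrightarrow> i \<le> j"
        by (rule attachment[OF True]) blast
      ultimately show False using y(2) by auto
    qed
    then show ?thesis using x y True by auto
  next
    case False
    then obtain i where i: "y = P i" "i \<le> r" using y by (auto simp: off_chain_def)
    then have le: "y \<le> P r" by (simp add: chain_le_iff)
    then have "x \<le> P r" using y(2) by (rule order_trans[rotated])
    then have "x \<notin> off_chain" using not_le_top by blast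
    then have "x = P r" using x by blast
    then show ?thesis using le y(2) by auto
  qed
  then show "x \<in> {x \<in> S. \<forall>y\<in>S. x \<le> y \<longrightarrow> y = x}" using x chain_mem[of r] by (auto simp: off_chain_def)
qed

lemma count_one:
  assumes a: "off_chain = {a}" and j: "j < r" "\<And>i. i \<le> r \<Longrightarrow> P i \<le> a \<longleftrightarrow> i \<le> j"
  shows "card (downsets S - {{}}) = Suc r + (Suc r - j)"
proof -
  have "card (cuts {a}) = Suc r - j" by (rule card_cuts_of_attachment[of a]) (use j in auto)
  then show ?thesis unfolding card_downsets a downsets_singleton by simp
qed

lemma count_two_comparable:
  assumes ab: "off_chain = {a, b}" "a < b" and j: "j < r" "\<And>i. i \<le> r \<Longrightarrow> P i \<le> a \<longleftrightarrow> i \<le> j"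
  shows "card (downsets S - {{}}) = Suc r + 2 * (Suc r - j)"
proof -
  have b: "P i \<le> b \<longleftrightarrow> i \<le> j" if "i \<le> r" for i
    using same_attachment[of a b i] ab j(2) that by auto
  have ne: "{a} \<noteq> {a, b}" using ab(2) by auto
  have 1: "card (cuts {a}) = Suc r - j" by (rule card_cuts_of_attachment[of a]) (use j in auto)
  have 2: "card (cuts {a, b}) = Suc r - j"
    by (rule card_cuts_of_attachment[of a]) (use j b in auto)
  show ?thesis
    unfolding card_downsets unfolding ab(1) downsets_doubleton_less[OF ab(2)] using ne 1 2 by simp
qed

lemma count_two_incomparable:
  assumes "off_chain = {a, b}" "\<not> a \<le> b" "\<not> b \<le> a"
    and j: "j < r" "\<And>i. i \<le> r \<Longrightarrow> P i \<le> a \<longleftrightarrow> i \<le> j"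
    and k: "k < r" "\<And>i. i \<le> r \<Longrightarrow> P i \<le> b \<longleftrightarrow> i \<le> k"
  shows "card (downsets S - {{}}) = Suc r + ((Suc r - j) + (Suc r - k) + (Suc r - max j k))"
proof -
  have ab: "a \<noteq> b" using assms by auto
  have 1: "card (cuts {a}) = Suc r - j" by (rule card_cuts_of_attachment[of a]) (use j in auto)
  have 2: "card (cuts {b}) = Suc r - k" by (rule card_cuts_of_attachment[of b]) (use k in auto)
  have 3: "card (cuts {a, b}) = Suc r - max j k"
    by (rule card_cuts_of_attachment[of "if k \<le> j then a else b"]) (use j k in \<open>auto simp: max_def\<close>)
  show ?thesis
    unfolding card_downsets unfolding assms(1) downsets_doubleton_incomparable[OF assms(2,3)]
    using ab 1 2 3 by (simp add: doubleton_eq_iff)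
qed

text \<open>
  The numbers of cuts add up to \<open>6\<close> and are at least \<open>2\<close>, so \<open>off_chain\<close> has at most three nonempty
  downsets.  Each of its elements generates a different one, so it has at most three elements.  If
  there are three, they generate all the downsets; in particular one of them is the largest, and
  every number of cuts is \<open>2\<close>.  Then two elements \<open>a < t\<close> off the chain lie above \<open>P (r - 1)\<close>, which
  gives a chain that is too long.
\<close>

lemma downset_count_cases:
  assumes card: "card (downsets S - {{}}) = 7 + r"
  obtains (three) a b where "off_chain = {a, b}" "\<not> a \<le> b" "\<not> b \<le> a" "1 \<le> r" "P (r - 1) < a" "P (r - 1) < b"
  | (one) a where "off_chain = {a}" "5 \<le> r" "P (r - 5) < a" "\<not> P (r - 4) \<le> a"
  | (two) a b where "off_chain = {a, b}" "a < b" "2 \<le> r" "P (r - 2) < a"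
proof -
  let ?N = "downsets off_chain - {{}}"
  have finN: "finite ?N" using finite_downsets[OF finite_off_chain] by simp
  have sum: "(\<Sum>F\<in>?N. card (cuts F)) = 6" using card card_downsets by simp
  have ge2: "2 \<le> card (cuts F)" if "F \<in> ?N" for F
    using that by (intro two_le_card_cuts) (auto simp: downsets_def)
  have "2 * card ?N \<le> 6"
    using sum_mono[of ?N "\<lambda>_. 2" "\<lambda>F. card (cuts F)"] ge2 sum by simp
  then have N3: "card ?N \<le> 3" by simp
  define below where "below e = {x \<in> off_chain. x \<le> e}" for e
  have bN: "below ` off_chain \<subseteq> ?N" by (auto simp: below_def downsets_def intro: order_trans)
  have inj: "inj_on below off_chain"
  proof (rule inj_onI)
    fix x y assume xy: "x \<in> off_chain" "y \<in> off_chain" "below x = below y"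
    then have "x \<in> below y" "y \<in> below x" unfolding below_def by blast+
    then show "x = y" by (auto simp: below_def)
  qed
  have EN: "card off_chain \<le> card ?N" by (rule card_inj_on_le[OF inj bN finN])
  have lt: "P j < e" if "P j \<le> e" "e \<in> off_chain" "j < r" for j e
    using that by (auto simp: off_chain_def less_le)
  have "off_chain \<noteq> {}"
  proof
    assume "off_chain = {}"
    then have "?N = {}" by (auto simp: downsets_def)
    then show False using sum by (simp only: sum.empty)
  qed
  have comparable: thesis if ab: "off_chain = {a, b}" "a < b" for a b
  proof -
    obtain j where j: "j < r" "\<And>i. i \<le> r \<Longrightarrow> P i \<le> a \<longleftrightarrow> i \<le> j" using attachment[of a] ab by blast
    have "2 * (Suc r - j) = 6" using count_two_comparable[OF ab j] card by simp
    then have "2 \<le> r" "j = r - 2" using j(1) by auto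
    then show ?thesis using two[OF ab] j lt[of j a] ab(1) by auto
  qed
  have "card off_chain \<noteq> 0" using \<open>off_chain \<noteq> {}\<close> finite_off_chain by simp
  then consider "card off_chain = 1" | "card off_chain = 2" | "card off_chain = 3" using EN N3 by linarith
  then show thesis
  proof cases
    case 1
    then obtain a where a: "off_chain = {a}" using card_1_singletonE by blast
    obtain j where j: "j < r" "\<And>i. i \<le> r \<Longrightarrow> P i \<le> a \<longleftrightarrow> i \<le> j" using attachment[of a] a by blast
    have "Suc r - j = 6" using count_one[OF a j] card by simp
    then have r: "5 \<le> r" "j = r - 5" using j(1) by auto
    show ?thesis
      by (rule that(2)[of a]) (use a r j lt[of "r - 5" a] in auto)
  next
    case 2
    then obtain a b where ab: "off_chain = {a, b}" "a \<noteq> b" by (meson card_2_iff)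
    consider "a < b" | "b < a" | "\<not> a \<le> b" "\<not> b \<le> a" using ab(2) by (auto simp: less_le)
    then show ?thesis
    proof cases
      case 1 then show ?thesis using comparable ab(1) by blast
    next
      case 2
      moreover have "off_chain = {b, a}" using ab by auto
      ultimately show ?thesis using comparable by blast
    next
      case 3
      obtain j where j: "j < r" "\<And>i. i \<le> r \<Longrightarrow> P i \<le> a \<longleftrightarrow> i \<le> j" using attachment[of a] ab by blast
      obtain k where k: "k < r" "\<And>i. i \<le> r \<Longrightarrow> P i \<le> b \<longleftrightarrow> i \<le> k" using attachment[of b] ab by blast
      have "(Suc r - j) + (Suc r - k) + (Suc r - max j k) = 6"
        using count_two_incomparable[OF ab(1) 3 j k] card by simp
      then have "1 \<le> r" "j = r - 1" "k = r - 1" using j(1) k(1) by (auto simp: max_def split: if_splits)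
      then show ?thesis
        using that(1)[OF ab(1) 3] j k lt[of "r - 1"] ab(1) by auto
    qed
  next
    case 3
    then have N3': "card ?N = 3" using EN N3 by simp
    have img: "below ` off_chain = ?N"
      using card_subset_eq[OF finN bN] card_image[OF inj] 3 N3' by simp
    have "off_chain \<in> ?N" using \<open>off_chain \<noteq> {}\<close> by (auto simp: downsets_def)
    then obtain t where t: "t \<in> off_chain" "off_chain = below t" using img by blast
    have "card (off_chain - {t}) = 2" using 3 t(1) finite_off_chain by simp
    then obtain a where a: "a \<in> off_chain" "a \<noteq> t" by (metis Diff_iff card.empty ex_in_conv singletonI zero_neq_numeral)
    have "a \<in> below t" using a(1) by (subst t(2)[symmetric])
    then have at: "a < t" using a(2) by (simp add: below_def less_le)
    have bel: "below a \<in> ?N" using bN a by blast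
    have "card (cuts (below a)) = 2"
    proof (rule ccontr)
      assume "card (cuts (below a)) \<noteq> 2"
      then have "2 < card (cuts (below a))" using ge2[OF bel] by simp
      then have "(\<Sum>F\<in>?N. 2) < (\<Sum>F\<in>?N. card (cuts F))"
        using ge2 bel by (intro sum_strict_mono_ex1[OF finN]) auto
      then show False using sum N3' by simp
    qed
    moreover obtain j where j: "j < r" "\<And>i. i \<le> r \<Longrightarrow> P i \<le> a \<longleftrightarrow> i \<le> j" by (rule attachment[OF a(1)]) blast
    have "card (cuts (below a)) = Suc r - j"
      by (rule card_cuts_of_attachment[of a]) (use a j in \<open>auto simp: below_def intro: order_trans\<close>)
    ultimately have jr: "j = r - 1" "1 \<le> r" using j(1) by auto
    have Pa: "P (r - 1) < a" using lt[OF _ a(1) j(1)] j jr by auto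
    have False
      by (rule no_two_above[OF jr(2) Pa at]) (use a(1) t(1) in \<open>auto simp: off_chain_def\<close>)
    then show ?thesis ..
  qed
qed

end

section \<open>Spectra with seven overrings more than the dimension\<close>

text \<open>
  A finite supremum of natural numbers is attained.
\<close>

lemma krull_dim_chain:
  assumes kd: "krull_dim A = enat r" and ne: "prime_ideals A \<noteq> {}"
  obtains P where "\<And>i. i \<le> r \<Longrightarrow> P i \<in> prime_ideals A" "\<And>i. i < r \<Longrightarrow> P i \<subset> P (Suc i)"
proof -
  let ?C = "\<lambda>n. \<exists>P. (\<forall>i\<le>n. P i \<in> prime_ideals A) \<and> (\<forall>i<n. P i \<subset> P (Suc i))"
  have sup: "Sup {enat n | n. ?C n} = enat r" using kd by (simp add: krull_dim_def)
  have "?C r"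
  proof (rule ccontr)
    assume n: "\<not> ?C r"
    obtain Q where "Q \<in> prime_ideals A" using ne by blast
    then have "?C 0" by (intro exI[of _ "\<lambda>_. Q"]) auto
    then have "r \<noteq> 0" using n by metis
    then obtain k where k: "r = Suc k" using not0_implies_Suc by blast
    have "Sup {enat n | n. ?C n} \<le> enat k"
    proof (rule Sup_least)
      fix x assume "x \<in> {enat n | n. ?C n}"
      then obtain n where x: "x = enat n" "?C n" by blast
      then have "enat n \<le> enat r" unfolding sup[symmetric] by (intro Sup_upper) blast
      moreover have "n \<noteq> r" using x(2) \<open>\<not> ?C r\<close> by metis
      ultimately show "x \<le> enat k" using x(1) k by simp
    qed
    then show False using sup k by simp
  qed
  then show thesis using that by blast
qed

lemma krull_dim_no_longer_chain:
  assumes kd: "krull_dim A = enat r"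
  shows "\<not> (\<exists>Q. (\<forall>i\<le>Suc r. Q i \<in> prime_ideals A) \<and> (\<forall>i<Suc r. Q i \<subset> Q (Suc i)))"
proof
  assume "\<exists>Q. (\<forall>i\<le>Suc r. Q i \<in> prime_ideals A) \<and> (\<forall>i<Suc r. Q i \<subset> Q (Suc i))"
  then have "enat (Suc r) \<le> krull_dim A"
    unfolding krull_dim_def by (intro Sup_upper) blast
  then show False using kd by simp
qed

context fraction_domain
begin

text \<open>
  Otherwise \<open>{\<zero>}\<close> could be put in front of the chain.
\<close>

lemma chain_starts_at_zero:
  assumes kd: "krull_dim (L\<lparr>carrier := R\<rparr>) = enat r"
    and P: "\<And>i. i \<le> r \<Longrightarrow> P i \<in> Spec" "\<And>i. i < r \<Longrightarrow> P i \<subset> P (Suc i)"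
  shows "P 0 = {\<zero>}"
proof (rule ccontr)
  assume n: "P 0 \<noteq> {\<zero>}"
  define Q where "Q i = (if i = 0 then {\<zero>} else P (i - 1))" for i
  have "{\<zero>} \<subset> P 0" using n subalgebraD(2)[OF SpecD(1)[OF P(1)[of 0]]] by auto
  then have "Q i \<subset> Q (Suc i)" if "i < Suc r" for i
    using P(2)[of "i - 1"] that by (cases i) (auto simp: Q_def)
  moreover have "Q i \<in> Spec" if "i \<le> Suc r" for i
    using P(1)[of "i - 1"] that zero_in_Spec by (cases i) (auto simp: Q_def)
  ultimately show False using krull_dim_no_longer_chain[OF kd] unfolding Spec_def by blast
qed

lemma Spec_tree_with_longest_chain:
  assumes ar: arithmetical and fin: "finite Spec" and kd: "krull_dim (L\<lparr>carrier := R\<rparr>) = enat r"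
    and P: "\<And>i. i \<le> r \<Longrightarrow> P i \<in> Spec" "\<And>i. i < r \<Longrightarrow> P i \<subset> P (Suc i)"
  shows "tree_with_longest_chain Spec P r"
proof
  show "P 0 \<le> x" if "x \<in> Spec" for x
    using chain_starts_at_zero[where P = P and r = r, OF kd P] subalgebraD(2)[OF SpecD(1)[OF that]] by auto
  show "x \<le> y \<or> y \<le> x" if "x \<in> Spec" "y \<in> Spec" "z \<in> Spec" "x \<le> z" "y \<le> z" for x y z
    using Spec_tree[OF ar that] .
  show "\<not> (\<exists>Q. (\<forall>i\<le>Suc r. Q i \<in> Spec) \<and> (\<forall>i<Suc r. Q i < Q (Suc i)))"
    using krull_dim_no_longer_chain[OF kd] unfolding Spec_def .
qed (use fin P in auto)

text \<open>
  The product of an element of \<open>A - Q\<close>, one of \<open>B - Q\<close> and one of \<open>C - Q\<close> lies in the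
  intersection, but not in the prime \<open>Q\<close>.
\<close>

lemma prime_psubset_Int:
  assumes "Q \<in> Spec" "A \<in> Spec" "B \<in> Spec" "C \<in> Spec" "Q \<subset> A" "Q \<subset> B" "Q \<subset> C"
  shows "Q \<subset> A \<inter> B \<inter> C"
proof -
  obtain a b c where e: "a \<in> A" "a \<notin> Q" "b \<in> B" "b \<notin> Q" "c \<in> C" "c \<notin> Q" using assms(5-7) by blast
  have R: "a \<in> R" "b \<in> R" "c \<in> R" using e SpecD(2) assms(2-4) by auto
  then have c: "a \<in> carrier L" "b \<in> carrier L" "c \<in> carrier L" using R_carr by auto
  have ab: "a \<otimes> b \<in> R" using R R_subringE(6) by blast
  have 1: "(a \<otimes> b) \<otimes> c \<notin> Q"
    using SpecD(4)[OF assms(1) ab R(3)] SpecD(4)[OF assms(1) R(1,2)] e by blast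
  have "c \<otimes> (b \<otimes> a) \<in> A" "c \<otimes> (a \<otimes> b) \<in> B" "(a \<otimes> b) \<otimes> c \<in> C"
    using subalgebraD(4)[OF SpecD(1)] assms(2-4) R ab e by auto
  moreover have "c \<otimes> (b \<otimes> a) = (a \<otimes> b) \<otimes> c" "c \<otimes> (a \<otimes> b) = (a \<otimes> b) \<otimes> c" using c by algebra+
  ultimately have "(a \<otimes> b) \<otimes> c \<in> A \<inter> B \<inter> C" by simp
  then show ?thesis using 1 assms(5-7) by blast
qed

text \<open>
  The six downsets that reach off the longest chain arise as \<open>2 + 2 + 2\<close> from two incomparable
  elements \<open>a\<close>, \<open>b\<close> off the chain (through \<open>{a}\<close>, \<open>{b}\<close> and \<open>{a, b}\<close>), as \<open>6\<close> from a single
  element, or as \<open>3 + 3\<close> from two comparable elements.  These are the three shapes, in this order.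
\<close>

definition three_leaves :: "nat \<Rightarrow> bool" where
  "three_leaves r \<longleftrightarrow> (\<exists>P M1 M2 M3.
            maximal_ideals (L\<lparr>carrier := R\<rparr>) = {M1, M2, M3} \<and>
            prime_ideals (L\<lparr>carrier := R\<rparr>) = set (map P [0..<r] @ [M1, M2, M3]) \<and>
            distinct (map P [0..<r] @ [M1, M2, M3]) \<and>
            P 0 = {\<zero>} \<and> (\<forall>i. Suc i < r \<longrightarrow> P i \<subset> P (Suc i)) \<and>
            P (r - 1) \<subset> M1 \<inter> M2 \<inter> M3)"

definition long_and_short_leaf :: "nat \<Rightarrow> bool" where
  "long_and_short_leaf r \<longleftrightarrow> 5 \<le> r \<and> (\<exists>P M N.
            maximal_ideals (L\<lparr>carrier := R\<rparr>) = {M, N} \<and>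
            prime_ideals (L\<lparr>carrier := R\<rparr>) = set (map P [0..<Suc r] @ [N]) \<and>
            distinct (map P [0..<Suc r] @ [N]) \<and>
            P 0 = {\<zero>} \<and> (\<forall>i<r. P i \<subset> P (Suc i)) \<and> P r = M \<and>
            \<not> P (r - 4) \<subseteq> N \<and> P (r - 5) \<subset> N)"

definition two_equal_branches :: "nat \<Rightarrow> bool" where
  "two_equal_branches r \<longleftrightarrow> 2 \<le> r \<and> (\<exists>P M Q N.
            maximal_ideals (L\<lparr>carrier := R\<rparr>) = {M, N} \<and>
            prime_ideals (L\<lparr>carrier := R\<rparr>) = set (map P [0..<Suc r] @ [Q, N]) \<and>
            distinct (map P [0..<Suc r] @ [Q, N]) \<and>
            P 0 = {\<zero>} \<and> (\<forall>i<r. P i \<subset> P (Suc i)) \<and> P r = M \<and>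
            P (r - 2) \<subset> Q \<and> Q \<subset> N)"

lemma shape_if_downset_count:
  assumes ar: arithmetical and fin: "finite Spec" and kd: "krull_dim (L\<lparr>carrier := R\<rparr>) = enat r"
    and card: "card (downsets Spec - {{}}) = 7 + r"
  shows "three_leaves r \<or> long_and_short_leaf r \<or> two_equal_branches r"
proof -
  obtain P where P: "\<And>i. i \<le> r \<Longrightarrow> P i \<in> Spec" "\<And>i. i < r \<Longrightarrow> P i \<subset> P (Suc i)"
    using krull_dim_chain[OF kd] zero_in_Spec unfolding Spec_def by blast
  interpret T: tree_with_longest_chain Spec P r
    by (rule Spec_tree_with_longest_chain[where P = P and r = r, OF ar fin kd P])
  have P0: "P 0 = {\<zero>}" by (rule chain_starts_at_zero[where P = P and r = r, OF kd P])
  have Spec: "prime_ideals (L\<lparr>carrier := R\<rparr>) = P ` {..r} \<union> T.off_chain"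
    using P(1) unfolding Spec_def[symmetric] T.off_chain_def by auto
  have max: "maximal_ideals (L\<lparr>carrier := R\<rparr>) = insert (P r) {x \<in> T.off_chain. \<forall>y\<in>T.off_chain. x \<subseteq> y \<longrightarrow> y = x}"
    unfolding maximal_ideals_eq by (rule T.maximal_elements)
  have inj: "inj_on P {..r}"
    by (rule inj_onI) (metis T.chain_le_iff atMost_iff order_antisym order_refl)
  have off: "e \<noteq> P i" if "e \<in> T.off_chain" "i \<le> r" for e i using that by (auto simp: T.off_chain_def)
  have dist: "distinct (map P [0..<n] @ es)"
    if n: "n \<le> Suc r" "distinct es" "set es \<subseteq> T.off_chain \<union> P ` {n..r}" for n es
  proof -
    have "inj_on P {0..<n}" by (rule inj_on_subset[OF inj]) (use n(1) in auto)
    moreover have "P i \<noteq> e" if ie: "i < n" "e \<in> set es" for i e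
    proof (cases "e \<in> T.off_chain")
      case True then show ?thesis using off[of e i] ie(1) n(1) by auto
    next
      case False
      then obtain k where k: "e = P k" "n \<le> k" "k \<le> r"
        using n(3) ie(2) by auto
      then show ?thesis using inj_onD[OF inj, of i k] ie(1) by auto
    qed
    then have "P i \<notin> set es" if "i < n" for i using that by blast
    ultimately show ?thesis using n(2) by (auto simp: distinct_map)
  qed
  from card show ?thesis
  proof (cases rule: T.downset_count_cases)
    case (three a b)
    have S: "a \<in> Spec" "b \<in> Spec" using three(1) by (auto simp: T.off_chain_def)
    have lt: "P (r - 1) \<subset> P r" using T.chain_less[of "r - 1" r] three(4) by simp
    have "{..r} = insert r {0..<r}" by auto
    then have "prime_ideals (L\<lparr>carrier := R\<rparr>) = set (map P [0..<r] @ [P r, a, b])"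
      unfolding Spec three(1) by auto
    moreover have "distinct (map P [0..<r] @ [P r, a, b])"
      by (rule dist) (use three off[of a r] off[of b r] in auto)
    moreover have "maximal_ideals (L\<lparr>carrier := R\<rparr>) = {P r, a, b}"
      unfolding max using three by auto
    moreover have "P (r - 1) \<subset> P r \<inter> a \<inter> b"
      by (rule prime_psubset_Int) (use P S lt three in auto)
    moreover have "\<forall>i. Suc i < r \<longrightarrow> P i \<subset> P (Suc i)" using P(2) by simp
    ultimately have "three_leaves r"
      using P0 unfolding three_leaves_def
      by (intro exI[of _ P] exI[of _ "P r"] exI[of _ a] exI[of _ b] conjI)
    then show ?thesis by blast
  next
    case (one a)
    have "prime_ideals (L\<lparr>carrier := R\<rparr>) = set (map P [0..<Suc r] @ [a])"
      unfolding Spec one(1) set_append set_map set_upt atLeast0LessThan lessThan_Suc_atMost by simp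
    moreover have "distinct (map P [0..<Suc r] @ [a])"
      by (rule dist) (use one in auto)
    moreover have "maximal_ideals (L\<lparr>carrier := R\<rparr>) = {P r, a}"
      unfolding max using one by auto
    moreover have "\<forall>i<r. P i \<subset> P (Suc i)" using P(2) by simp
    ultimately have "long_and_short_leaf r"
      using P0 one(2-4) unfolding long_and_short_leaf_def
      by (intro exI[of _ P] exI[of _ "P r"] exI[of _ a] conjI refl)
    then show ?thesis by blast
  next
    case (two a b)
    have "prime_ideals (L\<lparr>carrier := R\<rparr>) = set (map P [0..<Suc r] @ [a, b])"
      unfolding Spec two(1) set_append set_map set_upt atLeast0LessThan lessThan_Suc_atMost by simp
    moreover have "distinct (map P [0..<Suc r] @ [a, b])"
      by (rule dist) (use two in auto)
    moreover have "maximal_ideals (L\<lparr>carrier := R\<rparr>) = {P r, b}"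
      unfolding max using two by auto
    moreover have "\<forall>i<r. P i \<subset> P (Suc i)" using P(2) by simp
    ultimately have "two_equal_branches r"
      using P0 two(2-4) unfolding two_equal_branches_def
      by (intro exI[of _ P] exI[of _ "P r"] exI[of _ a] exI[of _ b] conjI refl)
    then show ?thesis by blast
  qed
qed

lemma maximal_ideals_antichain:
  assumes "M \<in> maximal_ideals (L\<lparr>carrier := R\<rparr>)" "N \<in> Spec" "M \<noteq> N"
  shows "\<not> M \<subseteq> N"
  using assms unfolding maximal_ideals_eq by blast

lemma downset_count_if_three_leaves:
  assumes ar: arithmetical and kd: "krull_dim (L\<lparr>carrier := R\<rparr>) = enat r" and "three_leaves r"
  shows "finite Spec \<and> card (downsets Spec - {{}}) = 7 + r"
proof -
  obtain P M1 M2 M3 where max: "maximal_ideals (L\<lparr>carrier := R\<rparr>) = {M1, M2, M3}"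
    and Spec: "Spec = set (map P [0..<r] @ [M1, M2, M3])"
    and dist: "distinct (map P [0..<r] @ [M1, M2, M3])"
    and P: "P 0 = {\<zero>}" "\<forall>i. Suc i < r \<longrightarrow> P i \<subset> P (Suc i)" "P (r - 1) \<subset> M1 \<inter> M2 \<inter> M3"
    using assms(3) unfolding three_leaves_def Spec_def[symmetric] by (elim exE conjE) (rule that)
  have fin: "finite Spec" unfolding Spec by simp
  have r: "1 \<le> r"
  proof (rule ccontr)
    assume "\<not> 1 \<le> r"
    then have "r = 0" by simp
    then have "{\<zero>} \<in> {M1, M2, M3}" using zero_in_Spec Spec by auto
    then show False using P(1,3) \<open>r = 0\<close> by auto
  qed
  \<comment> \<open>any of the three maximal ideals may end the longest chain\<close>
  define C where "C i = (if i < r then P i else M1)" for i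
  have C: "C i \<in> Spec" if "i \<le> r" for i using that unfolding Spec C_def by auto
  have CS: "C i \<subset> C (Suc i)" if "i < r" for i
  proof (cases "Suc i = r")
    case True
    then have "i = r - 1" by simp
    then show ?thesis using P(3) True by (auto simp: C_def)
  next
    case False
    then show ?thesis using P(2) that by (simp add: C_def)
  qed
  interpret T: tree_with_longest_chain Spec C r
    by (rule Spec_tree_with_longest_chain[where P = C and r = r, OF ar fin kd C CS])
  have CP: "C ` {..r} = insert M1 (P ` {0..<r})" by (auto simp: C_def)
  have SP: "Spec = insert M1 (P ` {0..<r}) \<union> {M2, M3}" unfolding Spec by auto
  have "M2 \<notin> insert M1 (P ` {0..<r})" "M3 \<notin> insert M1 (P ` {0..<r})" using dist by auto
  then have E: "T.off_chain = {M2, M3}" unfolding T.off_chain_def CP unfolding SP by blast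
  have anti: "\<not> M \<subseteq> N" if "M \<in> {M1, M2, M3}" "N \<in> {M1, M2, M3}" "M \<noteq> N" for M N
    using maximal_ideals_antichain[of M N] that max Spec by auto
  have ne: "M1 \<noteq> M2" "M1 \<noteq> M3" "M2 \<noteq> M3" using dist by auto
  have j: "C i \<subseteq> N \<longleftrightarrow> i \<le> r - 1" if N: "N = M2 \<or> N = M3" and i: "i \<le> r" for N i
  proof
    assume le: "C i \<subseteq> N"
    show "i \<le> r - 1"
    proof (rule ccontr)
      assume "\<not> i \<le> r - 1"
      then have "i = r" using i by linarith
      then have "C i = M1" using i by (auto simp: C_def)
      then show False using anti[of M1 N] le N ne by auto
    qed
  next
    assume "i \<le> r - 1"
    then have "C i \<subseteq> C (r - 1)" using T.chain_le_iff[of i "r - 1"] by simp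
    also have "\<dots> \<subseteq> N" using P(3) N r by (auto simp: C_def)
    finally show "C i \<subseteq> N" .
  qed
  have "card (downsets Spec - {{}}) = Suc r + ((Suc r - (r - 1)) + (Suc r - (r - 1)) + (Suc r - max (r - 1) (r - 1)))"
    by (rule T.count_two_incomparable[OF E]) (use anti ne j r in auto)
  then show ?thesis using fin r by simp
qed

lemma downset_count_if_long_and_short_leaf:
  assumes ar: arithmetical and kd: "krull_dim (L\<lparr>carrier := R\<rparr>) = enat r" and "long_and_short_leaf r"
  shows "finite Spec \<and> card (downsets Spec - {{}}) = 7 + r"
proof -
  obtain P M N where r: "5 \<le> r" and "maximal_ideals (L\<lparr>carrier := R\<rparr>) = {M, N}"
    and Spec: "Spec = set (map P [0..<Suc r] @ [N])"
    and dist: "distinct (map P [0..<Suc r] @ [N])"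
    and "P 0 = {\<zero>}" and P: "\<forall>i<r. P i \<subset> P (Suc i)" and "P r = M" and P': "\<not> P (r - 4) \<subseteq> N" "P (r - 5) \<subset> N"
    using assms(3) unfolding long_and_short_leaf_def Spec_def[symmetric] by (elim exE conjE) (rule that)
  have fin: "finite Spec" unfolding Spec by simp
  have C: "P i \<in> Spec" if "i \<le> r" for i
  proof -
    have "i \<in> {0..<Suc r}" using that by simp
    then show ?thesis unfolding Spec set_append set_map set_upt by blast
  qed
  interpret T: tree_with_longest_chain Spec P r
    by (rule Spec_tree_with_longest_chain[where P = P and r = r, OF ar fin kd C P[rule_format]])
  have SP: "Spec = P ` {..r} \<union> {N}"
    unfolding Spec set_append set_map set_upt atLeast0LessThan lessThan_Suc_atMost by simp
  have "N \<notin> P ` {..r}"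
    using dist unfolding distinct_append set_map set_upt atLeast0LessThan lessThan_Suc_atMost by auto
  then have E: "T.off_chain = {N}" unfolding T.off_chain_def unfolding SP by blast
  obtain j where j: "j < r" "\<And>i. i \<le> r \<Longrightarrow> P i \<le> N \<longleftrightarrow> i \<le> j" using T.attachment[of N] E by blast
  have "r - 5 \<le> j" "\<not> r - 4 \<le> j" using j(2)[of "r - 5"] j(2)[of "r - 4"] P'(1,2) by auto
  then have "j = r - 5" using r by linarith
  then show ?thesis using T.count_one[OF E j] fin r by simp
qed

lemma downset_count_if_two_equal_branches:
  assumes ar: arithmetical and kd: "krull_dim (L\<lparr>carrier := R\<rparr>) = enat r" and "two_equal_branches r"
  shows "finite Spec \<and> card (downsets Spec - {{}}) = 7 + r"
proof -
  obtain P M Q N where r: "2 \<le> r" and "maximal_ideals (L\<lparr>carrier := R\<rparr>) = {M, N}"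
    and Spec: "Spec = set (map P [0..<Suc r] @ [Q, N])"
    and dist: "distinct (map P [0..<Suc r] @ [Q, N])"
    and "P 0 = {\<zero>}" and P: "\<forall>i<r. P i \<subset> P (Suc i)" and "P r = M" and P': "P (r - 2) \<subset> Q" "Q \<subset> N"
    using assms(3) unfolding two_equal_branches_def Spec_def[symmetric] by (elim exE conjE) (rule that)
  have fin: "finite Spec" unfolding Spec by simp
  have C: "P i \<in> Spec" if "i \<le> r" for i
  proof -
    have "i \<in> {0..<Suc r}" using that by simp
    then show ?thesis unfolding Spec set_append set_map set_upt by blast
  qed
  interpret T: tree_with_longest_chain Spec P r
    by (rule Spec_tree_with_longest_chain[where P = P and r = r, OF ar fin kd C P[rule_format]])
  have SP: "Spec = P ` {..r} \<union> {Q, N}"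
    unfolding Spec set_append set_map set_upt atLeast0LessThan lessThan_Suc_atMost by simp
  have "N \<notin> P ` {..r}" "Q \<notin> P ` {..r}" "Q \<noteq> N"
    using dist unfolding distinct_append set_map set_upt atLeast0LessThan lessThan_Suc_atMost by auto
  then have E: "T.off_chain = {Q, N}" unfolding T.off_chain_def unfolding SP by blast
  have Q: "Q \<in> T.off_chain" using E by simp
  obtain j where j: "j < r" "\<And>i. i \<le> r \<Longrightarrow> P i \<le> Q \<longleftrightarrow> i \<le> j" using T.attachment[of Q] E by blast
  \<comment> \<open>\<open>j = r - 1\<close> would give the chain \<open>P 0, \<dots>, P (r - 1), Q, N\<close>, which is too long\<close>
  have "r - 2 \<le> j" using j(2)[of "r - 2"] P'(1) by auto
  moreover have "j \<noteq> r - 1"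
  proof
    assume "j = r - 1"
    then have "P (r - 1) \<subseteq> Q" using j by auto
    moreover have "P (r - 1) \<noteq> Q" using Q unfolding T.off_chain_def by auto
    ultimately have "P (r - 1) \<subset> Q" by blast
    moreover have "1 \<le> r" "Q \<in> Spec" "N \<in> Spec" using r unfolding SP by auto
    ultimately show False using T.no_two_above[of Q N] P'(2) by blast
  qed
  ultimately have "j = r - 2" using j(1) by linarith
  then show ?thesis using T.count_two_comparable[OF E P'(2) j] fin r by simp
qed

lemma card_overrings:
  assumes ar: arithmetical and fin: "finite Spec"
  shows "card (overrings L R) = card (downsets Spec - {{}})"
  using bij_betw_same_card[OF bij_betw_overrings_downsets[OF assms]] .

lemma card_overrings_iff_shape:
  assumes ar: arithmetical and kd: "krull_dim (L\<lparr>carrier := R\<rparr>) = enat r"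
  shows "card (overrings L R) = 7 + r \<longleftrightarrow>
    three_leaves r \<or> long_and_short_leaf r \<or> two_equal_branches r"
proof
  assume card: "card (overrings L R) = 7 + r"
  then have "finite (overrings L R)" using card.infinite by fastforce
  then have fin: "finite Spec" by (rule finite_Spec_if_finite_overrings)
  show "three_leaves r \<or> long_and_short_leaf r \<or> two_equal_branches r"
    using shape_if_downset_count[OF ar fin kd] card card_overrings[OF ar fin] by simp
next
  assume "three_leaves r \<or> long_and_short_leaf r \<or> two_equal_branches r"
  then have "finite Spec \<and> card (downsets Spec - {{}}) = 7 + r"
    using downset_count_if_three_leaves[OF ar kd] downset_count_if_long_and_short_leaf[OF ar kd]
      downset_count_if_two_equal_branches[OF ar kd] by blast
  then show "card (overrings L R) = 7 + r" using card_overrings[OF ar] by simp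
qed

lemma pruefer_iff_arithmetical: "pruefer_domain L R \<longleftrightarrow> arithmetical"
  using pruefer_if_arithmetical arithmetical_if_pruefer by blast

text \<open>
  A set of cardinality \<open>7 + r > 0\<close> is finite, so either count makes \<open>R\<close> arithmetical, and for an
  arithmetical \<open>R\<close> the two counts agree.
\<close>

lemma overrings_SSFc_pruefer_equivalence:
  assumes ic: "integrally_closed L R" and kd: "krull_dim (L\<lparr>carrier := R\<rparr>) = enat r"
  shows "(card (overrings L R) = 7 + r \<longleftrightarrow> card (SSFc L R) = 7 + r) \<and>
    (card (SSFc L R) = 7 + r \<longleftrightarrow>
      pruefer_domain L R \<and> (three_leaves r \<or> long_and_short_leaf r \<or> two_equal_branches r))"
proof -
  have same: "card (SSFc L R) = card (overrings L R)" if arithmetical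
    using bij_betw_same_card[OF bij_betw_overrings_SSFc[OF that]] by simp
  have "finite (overrings L R)" if "card (overrings L R) = 7 + r \<or> card (SSFc L R) = 7 + r"
    using that card.infinite finite_overrings_if_finite_SSFc by fastforce
  then have ar: arithmetical if "card (overrings L R) = 7 + r \<or> card (SSFc L R) = 7 + r"
    using arithmetical_if_finite_overrings[OF ic] that by blast
  show ?thesis
    unfolding pruefer_iff_arithmetical using ar same card_overrings_iff_shape[OF _ kd] by metis
qed

end

theorem theorem2p9:
  fixes L :: "('a, 'm) ring_scheme" and R :: "'a set" and r :: nat
  assumes "domain_with_quotient_field L R"
    and "integrally_closed L R"
    and "krull_dim (L\<lparr>carrier := R\<rparr>) = enat r"
  shows
    "(card (overrings L R) = 7 + r \<longleftrightarrow> card (SSFc L R) = 7 + r) \<and>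
     (card (SSFc L R) = 7 + r \<longleftrightarrow>
        pruefer_domain L R \<and>
        ((\<exists>P M1 M2 M3.
            maximal_ideals (L\<lparr>carrier := R\<rparr>) = {M1, M2, M3} \<and>
            prime_ideals (L\<lparr>carrier := R\<rparr>) = set (map P [0..<r] @ [M1, M2, M3]) \<and>
            distinct (map P [0..<r] @ [M1, M2, M3]) \<and>
            P 0 = {\<zero>\<^bsub>L\<^esub>} \<and> (\<forall>i. Suc i < r \<longrightarrow> P i \<subset> P (Suc i)) \<and>
            P (r - 1) \<subset> M1 \<inter> M2 \<inter> M3) \<or>
         (5 \<le> r \<and> (\<exists>P M N.
            maximal_ideals (L\<lparr>carrier := R\<rparr>) = {M, N} \<and>
            prime_ideals (L\<lparr>carrier := R\<rparr>) = set (map P [0..<Suc r] @ [N]) \<and>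
            distinct (map P [0..<Suc r] @ [N]) \<and>
            P 0 = {\<zero>\<^bsub>L\<^esub>} \<and> (\<forall>i<r. P i \<subset> P (Suc i)) \<and> P r = M \<and>
            \<not> P (r - 4) \<subseteq> N \<and> P (r - 5) \<subset> N)) \<or>
         (2 \<le> r \<and> (\<exists>P M Q N.
            maximal_ideals (L\<lparr>carrier := R\<rparr>) = {M, N} \<and>
            prime_ideals (L\<lparr>carrier := R\<rparr>) = set (map P [0..<Suc r] @ [Q, N]) \<and>
            distinct (map P [0..<Suc r] @ [Q, N]) \<and>
            P 0 = {\<zero>\<^bsub>L\<^esub>} \<and> (\<forall>i<r. P i \<subset> P (Suc i)) \<and> P r = M \<and>
            P (r - 2) \<subset> Q \<and> Q \<subset> N))))"
proof -
  interpret fraction_domain L R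
    using assms(1)
    by (auto simp: domain_with_quotient_field_def fraction_domain_def fraction_domain_axioms_def
        subdomain_def subcring_def)
  show ?thesis
    using overrings_SSFc_pruefer_equivalence[OF assms(2,3)]
    unfolding three_leaves_def long_and_short_leaf_def two_equal_branches_def .
qed

end
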